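(* Let $\Omega\subset\mathbb{R}^d$ be a bounded Lipschitz domain, $s\in(0,1)$, $\alpha>0$, $f\in L^2(\Omega)$ and $g\in[L^2_{s+\beta}(\Omega^c)]'$ for some $\beta\in(0,s)$. Then the unique solution $u\in\mathbb{V}$ of $$\langle u,v\rangle_{\mathbb{X}}+\alpha(u,v)_{L^2(\Omega)}=(f,v)_{L^2(\Omega)}+(g,v)_{L^2(\Omega^c)}\qquad\forall v\in\mathbb{V}$$ belongs to the space $L^2_{s-\beta}(\mathbb{R}^d)$, and it satisfies $$\|u\|_{L^2_{s-\beta}(\mathbb{R}^d)}\le C\left(\|g\|_{[L^2_{s+\beta}(\Omega^c)]'}+\|u\|_{\mathbb{V}}\right),$$ where $C>0$ is a constant independent of $f$, $g$ and $u$.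
   Context: $\Omega^c=\mathbb{R}^d\setminus\overline\Omega$, and $C_{d,s}=\frac{2^{2s}s\,\Gamma(s+d/2)}{\pi^{d/2}\Gamma(1-s)}$. $\langle u,v\rangle_{\mathbb{X}}=\frac{C_{d,s}}{2}\iint_{(\mathbb{R}^d\times\mathbb{R}^d)\setminus(\Omega^c\times\Omega^c)}\frac{(u(x)-u(y))(v(x)-v(y))}{|x-y|^{d+2s}}\,dx\,dy$, $|v|_{\mathbb{X}}=\langle v,v\rangle_{\mathbb{X}}^{1/2}$, $\|v\|_{\mathbb{V}}=(\|v\|_{L^2(\Omega)}^2+|v|_{\mathbb{X}}^2)^{1/2}$, and $\mathbb{V}=\{v:\mathbb{R}^d\to\mathbb{R}\text{ measurable}:\|v\|_{\mathbb{V}}<\infty\}$ (functions identified when equal a.e.). $(\cdot,\cdot)_{L^2(A)}$ denotes the integral over $A$ of the product. For $\gamma\in\mathbb{R}$, $\|v\|_{L^2_\gamma(\mathbb{R}^d)}=\Big(\int_{\mathbb{R}^d}\frac{|v(x)|^2}{1+|x|^{d+2\gamma}}\,dx\Big)^{1/2}$, and $L^2_\gamma(\mathbb{R}^d)$ is the space of measurable functions for which this is finite. The space $[L^2_\gamma(\Omega^c)]'$ consists of the measurable $g:\Omega^c\to\mathbb{R}$ with $\|g\|_{[L^2_\gamma(\Omega^c)]'}^2=\int_{\Omega^c}|g(x)|^2(1+|x|^{d+2\gamma})\,dx<\infty$. *)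

theory Defs
  imports "HOL-Analysis.Analysis"
begin

text \<open>
  The space \<open>\<real>\<^sup>d\<close> is an arbitrary type of class \<open>euclidean_space\<close> with \<open>d = DIM('a)\<close>. Measurability
  and integrals are in the sense of Lebesgue. Functions on a subset \<open>A\<close> are represented by total
  functions, whose values outside \<open>A\<close> are never used. Spaces are sets of functions rather than of
  equivalence classes; identification almost everywhere is made explicit where it is needed.
\<close>

text \<open>
  Near each boundary point the domain is the strict epigraph, in some direction \<open>e\<close>, of a Lipschitz
  function \<open>\<phi>\<close> on the hyperplane through the origin orthogonal to \<open>e\<close>.
\<close>

definition lipschitz_boundary :: "'a::euclidean_space set \<Rightarrow> bool" where
  "lipschitz_boundary \<Omega> \<longleftrightarrow>
    (\<forall>p \<in> frontier \<Omega>. \<exists>e r L \<phi>. norm e = 1 \<and> r > 0 \<and> L-lipschitz_on {z. z \<bullet> e = 0} \<phi> \<and>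
      (\<forall>y \<in> ball p r. y \<in> \<Omega> \<longleftrightarrow> \<phi> (y - (y \<bullet> e) *\<^sub>R e) < y \<bullet> e))"

definition bounded_lipschitz_domain :: "'a::euclidean_space set \<Rightarrow> bool" where
  "bounded_lipschitz_domain \<Omega> \<longleftrightarrow>
    open \<Omega> \<and> connected \<Omega> \<and> \<Omega> \<noteq> {} \<and> bounded \<Omega> \<and> lipschitz_boundary \<Omega>"

definition exterior :: "'a::euclidean_space set \<Rightarrow> 'a set" where
  "exterior \<Omega> = - closure \<Omega>"

definition frac_const :: "nat \<Rightarrow> real \<Rightarrow> real" where
  "frac_const d s =
    2 powr (2 * s) * s * Gamma (s + real d / 2) / (pi powr (real d / 2) * Gamma (1 - s))"

definition X_domain :: "'a::euclidean_space set \<Rightarrow> ('a \<times> 'a) set" where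
  "X_domain \<Omega> = UNIV - exterior \<Omega> \<times> exterior \<Omega>"

text \<open>The integrand is \<open>0\<close> on the diagonal.\<close>

definition X_integrand ::
    "real \<Rightarrow> ('a::euclidean_space \<Rightarrow> real) \<Rightarrow> ('a \<Rightarrow> real) \<Rightarrow> 'a \<times> 'a \<Rightarrow> real" where
  "X_integrand s u v = (\<lambda>(x, y).
    (u x - u y) * (v x - v y) / norm (x - y) powr (real DIM('a) + 2 * s))"

definition X_inner ::
    "real \<Rightarrow> 'a::euclidean_space set \<Rightarrow> ('a \<Rightarrow> real) \<Rightarrow> ('a \<Rightarrow> real) \<Rightarrow> real" where
  "X_inner s \<Omega> u v = frac_const DIM('a) s / 2 *
    (LINT z|lebesgue_on (X_domain \<Omega>). X_integrand s u v z)"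

definition X_norm :: "real \<Rightarrow> 'a::euclidean_space set \<Rightarrow> ('a \<Rightarrow> real) \<Rightarrow> real" where
  "X_norm s \<Omega> v = sqrt (X_inner s \<Omega> v v)"

definition L2_inner :: "'a::euclidean_space set \<Rightarrow> ('a \<Rightarrow> real) \<Rightarrow> ('a \<Rightarrow> real) \<Rightarrow> real" where
  "L2_inner A u v = (LINT x|lebesgue_on A. u x * v x)"

definition L2_norm :: "'a::euclidean_space set \<Rightarrow> ('a \<Rightarrow> real) \<Rightarrow> real" where
  "L2_norm A v = sqrt (L2_inner A v v)"

definition V_norm :: "real \<Rightarrow> 'a::euclidean_space set \<Rightarrow> ('a \<Rightarrow> real) \<Rightarrow> real" where
  "V_norm s \<Omega> v = sqrt ((L2_norm \<Omega> v)\<^sup>2 + (X_norm s \<Omega> v)\<^sup>2)"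

text \<open>
  The integrands of the squared norms are nonnegative and measurable, so finiteness of a norm is
  integrability of its integrand. The real-valued norms are meaningful only on these spaces.
\<close>

definition L2_space :: "'a::euclidean_space set \<Rightarrow> ('a \<Rightarrow> real) set" where
  "L2_space A = {v \<in> borel_measurable (lebesgue_on A). integrable (lebesgue_on A) (\<lambda>x. (v x)\<^sup>2)}"

definition V_space :: "real \<Rightarrow> 'a::euclidean_space set \<Rightarrow> ('a \<Rightarrow> real) set" where
  "V_space s \<Omega> = {v \<in> borel_measurable lebesgue.
    integrable (lebesgue_on \<Omega>) (\<lambda>x. (v x)\<^sup>2) \<and>
    integrable (lebesgue_on (X_domain \<Omega>)) (X_integrand s v v)}"

definition weight :: "real \<Rightarrow> 'a::euclidean_space \<Rightarrow> real" where
  "weight \<gamma> x = 1 + norm x powr (real DIM('a) + 2 * \<gamma>)"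

definition L2w_norm :: "real \<Rightarrow> ('a::euclidean_space \<Rightarrow> real) \<Rightarrow> real" where
  "L2w_norm \<gamma> v = sqrt (LINT x|lebesgue. \<bar>v x\<bar>\<^sup>2 / weight \<gamma> x)"

definition L2w_space :: "real \<Rightarrow> ('a::euclidean_space \<Rightarrow> real) set" where
  "L2w_space \<gamma> = {v \<in> borel_measurable lebesgue. integrable lebesgue (\<lambda>x. \<bar>v x\<bar>\<^sup>2 / weight \<gamma> x)}"

definition L2w_dual_norm :: "real \<Rightarrow> 'a::euclidean_space set \<Rightarrow> ('a \<Rightarrow> real) \<Rightarrow> real" where
  "L2w_dual_norm \<gamma> A g = sqrt (LINT x|lebesgue_on A. \<bar>g x\<bar>\<^sup>2 * weight \<gamma> x)"

definition L2w_dual_space :: "real \<Rightarrow> 'a::euclidean_space set \<Rightarrow> ('a \<Rightarrow> real) set" where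
  "L2w_dual_space \<gamma> A = {g \<in> borel_measurable (lebesgue_on A).
    integrable (lebesgue_on A) (\<lambda>x. \<bar>g x\<bar>\<^sup>2 * weight \<gamma> x)}"

definition solution :: "real \<Rightarrow> real \<Rightarrow> 'a::euclidean_space set \<Rightarrow>
    ('a \<Rightarrow> real) \<Rightarrow> ('a \<Rightarrow> real) \<Rightarrow> ('a \<Rightarrow> real) \<Rightarrow> bool" where
  "solution s \<alpha> \<Omega> f g u \<longleftrightarrow> u \<in> V_space s \<Omega> \<and>
    (\<forall>v \<in> V_space s \<Omega>.
      X_inner s \<Omega> u v + \<alpha> * L2_inner \<Omega> u v = L2_inner \<Omega> f v + L2_inner (exterior \<Omega>) g v)"

end

theory Submission
  imports Defs
begin

text \<open>
  The solution exists and is unique because the energy form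
  \<open>\<langle>u, v\<rangle>\<^sub>X + \<alpha> (u, v)\<close> is coercive on the energy space and the right-hand side is bounded there
  (Riesz representation). Existence and uniqueness rest on one inequality, \<open>L2w_bound_by_V_norm\<close>: since \<open>\<Omega>\<close> is
  bounded, the kernel \<open>|x - y|\<close> to the power \<open>-(d + 2s)\<close> with \<open>x \<in> \<Omega>\<close> is bounded below by a multiple
  of \<open>1 / weight s y\<close>, so that averaging \<open>v(y)\<^sup>2 \<le> 2 v(x)\<^sup>2 + 2 (v(x) - v(y))\<^sup>2\<close> over \<open>x \<in> \<Omega>\<close> bounds
  \<open>v\<close> in the weighted space of order \<open>s\<close> by its energy norm. This makes the exterior pairing with \<open>g\<close>
  bounded, makes rapidly Cauchy sequences of the energy norm convergent almost everywhere (so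
  the space is complete, by Fatou), and controls functions of zero energy (so the solution is unique).

  The gain from order \<open>s\<close> to order \<open>s - \<beta>\<close> comes from the equation in the exterior, where
  no interaction between two exterior points is counted: there it is the nonlocal Neumann condition
  \<open>C \<integral> (u(y) - u(x)) / |x - y|^(d + 2s) dx = g(y)\<close>, the integral being over \<open>x \<in> closure \<Omega>\<close>. For large \<open>|y|\<close> it
  says that \<open>u(y)\<close> is an average of \<open>u\<close> over \<open>closure \<Omega>\<close> plus a term of size \<open>|y|^(d + 2s) |g(y)|\<close>.
  Averages are square integrable against \<open>1 / weight (s - \<beta>)\<close> because \<open>s - \<beta> > 0\<close>, and the second
  term is so by the assumption on \<open>g\<close>, because \<open>2 (d + 2s) - (d + 2 (s - \<beta>)) = d + 2 (s + \<beta>)\<close>.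

  The argument is carried out in integrated form, without deriving the pointwise condition. The equation
  is tested with \<open>v = |y|^(d + 2s) u / weight (s - \<beta>)\<close> cut off to a bounded set \<open>A\<close> far from \<open>\<Omega>\<close>
  (a cut-off is needed, as \<open>v\<close> is not known to have finite energy otherwise).
  On \<open>closure \<Omega> \<times> A\<close> the kernel is comparable to \<open>|y|^-(d + 2s)\<close>, hence \<open>\<langle>u, v\<rangle>\<^sub>X\<close> dominates a multiple of
  \<open>\<integral> u\<^sup>2 / weight (s - \<beta>)\<close> over \<open>A\<close> up to a multiple of \<open>\<integral> u\<^sup>2\<close> over \<open>closure \<Omega>\<close>
  (\<open>X_inner_far_lower_bound\<close>), while Young's inequality absorbs \<open>(g, v)\<close>. The resulting bound
  (\<open>solution_tail_estimate\<close>) does not depend on \<open>A\<close>, so \<open>A\<close> can exhaust a neighbourhood of infinity.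
\<close>

section \<open>Square-integrable functions and Riesz representation\<close>

definition square_integrable :: "'b measure \<Rightarrow> ('b \<Rightarrow> real) set" where
  "square_integrable M = {f \<in> borel_measurable M. integrable M (\<lambda>x. (f x)\<^sup>2)}"

lemma square_integrable_mult:
  assumes "f \<in> square_integrable M" "h \<in> square_integrable M"
  shows "integrable M (\<lambda>x. f x * h x)"
proof (rule Bochner_Integration.integrable_bound)
  show "integrable M (\<lambda>x. (f x)\<^sup>2 + (h x)\<^sup>2)"
    using assms by (simp add: square_integrable_def)
  show "(\<lambda>x. f x * h x) \<in> borel_measurable M"
    using assms by (auto simp: square_integrable_def)
  have "\<bar>a * b\<bar> \<le> a\<^sup>2 + b\<^sup>2" for a b :: real
    using sum_squares_bound[of "\<bar>a\<bar>" "\<bar>b\<bar>"] mult_nonneg_nonneg[of "\<bar>a\<bar>" "\<bar>b\<bar>"]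
    by (simp only: abs_mult power2_abs) linarith
  then show "AE x in M. norm (f x * h x) \<le> norm ((f x)\<^sup>2 + (h x)\<^sup>2)"
    by simp
qed

lemma square_integrable_lincomb:
  assumes f: "f \<in> square_integrable M" and h: "h \<in> square_integrable M"
  shows "(\<lambda>x. a * f x + b * h x) \<in> square_integrable M"
proof -
  have "integrable M (\<lambda>x. a\<^sup>2 * (f x)\<^sup>2 + 2 * a * b * (f x * h x) + b\<^sup>2 * (h x)\<^sup>2)"
    using f h square_integrable_mult[OF f h] by (auto simp: square_integrable_def)
  moreover have "(a * f x + b * h x)\<^sup>2 = a\<^sup>2 * (f x)\<^sup>2 + 2 * a * b * (f x * h x) + b\<^sup>2 * (h x)\<^sup>2" for x
    by (simp add: power2_sum power_mult_distrib algebra_simps)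
  ultimately show ?thesis
    using f h by (auto simp: square_integrable_def)
qed

lemma integral_mult_lincomb:
  assumes "f \<in> square_integrable M" "h \<in> square_integrable M" "k \<in> square_integrable M"
  shows "(LINT x|M. (a * f x + b * h x) * k x) = a * (LINT x|M. f x * k x) + b * (LINT x|M. h x * k x)"
  using square_integrable_mult[OF assms(1,3)] square_integrable_mult[OF assms(2,3)]
  by (simp add: distrib_right mult.assoc)

text \<open>
  The common core of the Cauchy--Schwarz inequality for integrals, of its version for abstract
  semi-inner products, and of the first-variation argument for minimisers (the case \<open>q = 0\<close>).
\<close>

lemma nonneg_quadratic_discriminant:
  fixes q b r :: real
  assumes "\<And>t. 0 \<le> q + 2 * t * b + t\<^sup>2 * r"
  shows "b\<^sup>2 \<le> q * r"
proof (cases "r = 0")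
  case True
  have "b = 0"
  proof (rule ccontr)
    assume "b \<noteq> 0"
    then have "q + 2 * (- (q + 1) / (2 * b)) * b = -1"
      by (simp add: field_simps)
    then show False using assms[of "- (q + 1) / (2 * b)"] True by simp
  qed
  then show ?thesis using True by simp
next
  case False
  have "0 \<le> r"
  proof (rule ccontr)
    assume "\<not> 0 \<le> r"
    then have r: "r < 0" by simp
    \<comment> \<open>large enough for the quadratic term to beat the other two, and at least \<open>1\<close>\<close>
    define t where "t = (\<bar>b\<bar> * 2 + \<bar>q\<bar> + 1) / (- r) + 1"
    have t1: "t \<ge> 1" using r by (auto simp: t_def divide_nonneg_nonpos intro!: divide_nonneg_pos)
    have "t * r = - (\<bar>b\<bar> * 2 + \<bar>q\<bar> + 1) + r" using r by (simp add: t_def field_simps)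
    then have "t\<^sup>2 * r = t * (- (\<bar>b\<bar> * 2 + \<bar>q\<bar> + 1) + r)" by (simp add: power2_eq_square mult.assoc)
    then have "q + 2 * t * b + t\<^sup>2 * r = q + t * (2 * b - 2 * \<bar>b\<bar>) - t * \<bar>q\<bar> - t + t * r"
      by (simp add: algebra_simps)
    also have "\<dots> < 0"
    proof -
      have "t * (2 * b - 2 * \<bar>b\<bar>) \<le> 0" using t1 by (intro mult_nonneg_nonpos) auto
      moreover have "t * \<bar>q\<bar> \<ge> 1 * \<bar>q\<bar>" using t1 by (intro mult_right_mono) auto
      moreover have "t * r < 0" using t1 r by (simp add: mult_pos_neg)
      ultimately show ?thesis using t1 by linarith
    qed
    finally show False using assms[of t] by simp
  qed
  with False have r: "r > 0" by simp
  have "0 \<le> q + 2 * (- b / r) * b + (- b / r)\<^sup>2 * r" by (rule assms)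
  also have "\<dots> = q - b\<^sup>2 / r" using r by (simp add: power2_eq_square field_simps)
  finally show ?thesis using r by (simp add: field_simps)
qed

lemma square_integrable_Cauchy_Schwarz:
  assumes f: "f \<in> square_integrable M" and h: "h \<in> square_integrable M"
  shows "(LINT x|M. f x * h x)\<^sup>2 \<le> (LINT x|M. (f x)\<^sup>2) * (LINT x|M. (h x)\<^sup>2)"
proof (rule nonneg_quadratic_discriminant)
  fix t
  have "0 \<le> (LINT x|M. (f x + t * h x)\<^sup>2)" by simp
  also have "(\<lambda>x. (f x + t * h x)\<^sup>2) = (\<lambda>x. (f x)\<^sup>2 + 2 * t * (f x * h x) + t\<^sup>2 * (h x)\<^sup>2)"
    by (auto simp: power2_sum power_mult_distrib algebra_simps)
  also have "(LINT x|M. \<dots> x) = (LINT x|M. (f x)\<^sup>2) + 2 * t * (LINT x|M. f x * h x) + t\<^sup>2 * (LINT x|M. (h x)\<^sup>2)"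
    using f h square_integrable_mult[OF f h] by (simp add: square_integrable_def)
  finally show "0 \<le> (LINT x|M. (f x)\<^sup>2) + 2 * t * (LINT x|M. f x * h x) + t\<^sup>2 * (LINT x|M. (h x)\<^sup>2)" .
qed

text \<open>
  Lower semicontinuity of the \<open>L\<^sup>2\<close> norm under convergence almost everywhere. It gives both the
  completeness of the energy space and the passage from bounded cut-offs to a full neighbourhood of infinity.
\<close>

lemma square_integrable_Fatou:
  assumes h: "\<And>n. h n \<in> square_integrable M" and [measurable]: "l \<in> borel_measurable M"
    and lim: "AE x in M. (\<lambda>n. h n x) \<longlonglongrightarrow> l x"
    and bound: "\<forall>\<^sub>F n in sequentially. (LINT x|M. (h n x)\<^sup>2) \<le> c"
  shows "l \<in> square_integrable M" and "(LINT x|M. (l x)\<^sup>2) \<le> c"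
proof -
  have [measurable]: "\<And>n. h n \<in> borel_measurable M" and hi: "\<And>n. integrable M (\<lambda>x. (h n x)\<^sup>2)"
    using h by (auto simp: square_integrable_def)
  have c: "0 \<le> c"
  proof -
    obtain n where "(LINT x|M. (h n x)\<^sup>2) \<le> c"
      using bound eventually_happens[of _ sequentially] by auto
    moreover have "0 \<le> (LINT x|M. (h n x)\<^sup>2)" by simp
    ultimately show ?thesis by linarith
  qed
  have "(\<integral>\<^sup>+x. ennreal ((l x)\<^sup>2) \<partial>M) = (\<integral>\<^sup>+x. liminf (\<lambda>n. ennreal ((h n x)\<^sup>2)) \<partial>M)"
  proof (rule nn_integral_cong_AE)
    show "AE x in M. ennreal ((l x)\<^sup>2) = liminf (\<lambda>n. ennreal ((h n x)\<^sup>2))"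
      using lim
    proof eventually_elim
      case (elim x)
      then have "(\<lambda>n. ennreal ((h n x)\<^sup>2)) \<longlonglongrightarrow> ennreal ((l x)\<^sup>2)"
        by (intro tendsto_intros)
      then show ?case using lim_imp_Liminf[OF sequentially_bot] by metis
    qed
  qed
  also have "\<dots> \<le> liminf (\<lambda>n. \<integral>\<^sup>+x. ennreal ((h n x)\<^sup>2) \<partial>M)"
    by (rule nn_integral_liminf) measurable
  also have "\<dots> = liminf (\<lambda>n. ennreal (LINT x|M. (h n x)\<^sup>2))"
    using hi by (simp add: nn_integral_eq_integral)
  also have "\<dots> \<le> ennreal c"
    by (rule Liminf_le) (use bound in \<open>auto elim!: eventually_mono intro: ennreal_leI\<close>)
  finally have le: "(\<integral>\<^sup>+x. ennreal ((l x)\<^sup>2) \<partial>M) \<le> ennreal c" .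
  have int: "integrable M (\<lambda>x. (l x)\<^sup>2)"
    using le by (intro integrableI_bounded) (auto simp: le_less_trans[OF _ ennreal_less_top])
  then show "l \<in> square_integrable M" by (simp add: square_integrable_def)
  show "(LINT x|M. (l x)\<^sup>2) \<le> c"
    using le c by (simp add: nn_integral_eq_integral[OF int])
qed

text \<open>
  The functional \<open>v \<mapsto> B v v - 2 F v\<close> is bounded below. By the parallelogram identity a minimising
  sequence is Cauchy, and the first variation vanishes at its limit. Working with a semi-inner product on
  a set of functions avoids passing to classes modulo equality almost everywhere. Completeness is only
  asked for sequences of prescribed geometric rate, since a minimising sequence can be chosen to have it;
  that rate makes the sequences converge almost everywhere without passing to subsequences.
\<close>

lemma Riesz_representation_semi_inner_product:
  fixes X :: "('b \<Rightarrow> real) set" and B :: "('b \<Rightarrow> real) \<Rightarrow> ('b \<Rightarrow> real) \<Rightarrow> real" and F :: "('b \<Rightarrow> real) \<Rightarrow> real"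
  assumes ne: "X \<noteq> {}" and M: "0 \<le> M"
    and comb: "\<And>u v a b. u \<in> X \<Longrightarrow> v \<in> X \<Longrightarrow> (\<lambda>x. a * u x + b * v x) \<in> X"
    and sym: "\<And>u v. B u v = B v u"
    and lin: "\<And>u v w a b. u \<in> X \<Longrightarrow> v \<in> X \<Longrightarrow> w \<in> X \<Longrightarrow>
      B (\<lambda>x. a * u x + b * v x) w = a * B u w + b * B v w"
    and nonneg: "\<And>u. u \<in> X \<Longrightarrow> 0 \<le> B u u"
    and linF: "\<And>u v a b. u \<in> X \<Longrightarrow> v \<in> X \<Longrightarrow> F (\<lambda>x. a * u x + b * v x) = a * F u + b * F v"
    and bndF: "\<And>u. u \<in> X \<Longrightarrow> (F u)\<^sup>2 \<le> M * B u u"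
    and complete: "\<And>w. (\<And>k. w k \<in> X) \<Longrightarrow>
      (\<And>k m. k \<le> m \<Longrightarrow> B (\<lambda>x. w k x - w m x) (\<lambda>x. w k x - w m x) \<le> (1/4)^k) \<Longrightarrow>
      \<exists>u\<in>X. (\<lambda>k. B (\<lambda>x. w k x - u x) (\<lambda>x. w k x - u x)) \<longlonglongrightarrow> 0"
  shows "\<exists>u\<in>X. \<forall>v\<in>X. B u v = F v"
proof -
  have lin2: "B w (\<lambda>x. a * u x + b * v x) = a * B w u + b * B w v"
    if "u \<in> X" "v \<in> X" "w \<in> X" for u v w a b
    using lin[OF that] sym by simp
  have expand: "B (\<lambda>x. a * u x + b * v x) (\<lambda>x. a * u x + b * v x) =
      a\<^sup>2 * B u u + 2 * a * b * B u v + b\<^sup>2 * B v v"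
    if "u \<in> X" "v \<in> X" for u v a b
    using that comb[OF that] sym[of v u]
    by (simp add: lin lin2 algebra_simps power2_eq_square)
  have CS: "(B u v)\<^sup>2 \<le> B u u * B v v" if "u \<in> X" "v \<in> X" for u v
  proof (rule nonneg_quadratic_discriminant)
    fix t
    show "0 \<le> B u u + 2 * t * B u v + t\<^sup>2 * B v v"
      using expand[OF that, of 1 t] nonneg[OF comb[OF that, of 1 t]] by simp
  qed
  define J where "J v = B v v - 2 * F v" for v
  have Jlow: "- M \<le> J v" if "v \<in> X" for v
  proof -
    define q where "q = B v v"
    have q: "0 \<le> q" "(F v)\<^sup>2 \<le> M * q" using nonneg bndF that by (auto simp: q_def)
    have "2 * F v \<le> M + q"
    proof (rule power2_le_imp_le)
      have "4 * (M * q) \<le> (M + q)\<^sup>2"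
        using sum_squares_bound[of M q] by (simp add: power2_sum)
      then show "(2 * F v)\<^sup>2 \<le> (M + q)\<^sup>2" using q by (simp add: power_mult_distrib)
    qed (use q M in simp)
    then show ?thesis by (simp add: J_def q_def)
  qed
  define m where "m = Inf (J ` X)"
  have m: "m \<le> J v" if "v \<in> X" for v
    unfolding m_def using that Jlow by (intro cInf_lower bdd_belowI2[of _ "-M"]) auto
  have "\<exists>v\<in>X. J v < m + (1/4)^k / 4" for k :: nat
    using cInf_lessD[of "J ` X" "m + (1/4)^k / 4"] ne by (auto simp: m_def)
  then obtain w where wX: "\<And>k::nat. w k \<in> X" and wm: "\<And>k. J (w k) < m + (1/4)^k / 4"
    by metis
  \<comment> \<open>parallelogram identity, with the midpoint as competitor\<close>
  have cauchy: "B (\<lambda>x. w k x - w n x) (\<lambda>x. w k x - w n x) \<le> (1/4)^k" if "k \<le> n" for k n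
  proof -
    have mid: "(\<lambda>x. 1/2 * w k x + 1/2 * w n x) \<in> X" using wX by (intro comb)
    have "J (w k) + J (w n) = 2 * J (\<lambda>x. 1/2 * w k x + 1/2 * w n x)
        + 1/2 * B (\<lambda>x. 1 * w k x + (-1) * w n x) (\<lambda>x. 1 * w k x + (-1) * w n x)"
      unfolding J_def expand[OF wX wX] linF[OF wX wX] by (simp add: power2_eq_square field_simps)
    then have "B (\<lambda>x. w k x - w n x) (\<lambda>x. w k x - w n x) \<le> 2 * (J (w k) + J (w n) - 2 * m)"
      using m[OF mid] by simp
    also have "\<dots> \<le> 2 * ((1/4)^k / 4 + (1/4)^n / 4)"
      using wm[of k] wm[of n] by simp
    also have "\<dots> \<le> (1/4)^k"
    proof -
      have "(1/4::real)^n \<le> (1/4)^k" by (rule power_decreasing[OF that]) auto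
      then show ?thesis by argo
    qed
    finally show ?thesis .
  qed
  obtain u where u: "u \<in> X" and lim: "(\<lambda>k. B (\<lambda>x. w k x - u x) (\<lambda>x. w k x - u x)) \<longlonglongrightarrow> 0"
    using complete[OF wX cauchy] by auto
  have "B u v = F v" if v: "v \<in> X" for v
  proof -
    have diff: "(\<lambda>x. w k x - u x) \<in> X" for k
      using comb[OF wX u, of 1 k "-1"] by simp
    have "(\<lambda>k. (B (w k) v - B u v)\<^sup>2) \<longlonglongrightarrow> 0"
    proof (rule tendsto_sandwich[OF _ _ tendsto_const])
      show "(\<lambda>k. B (\<lambda>x. w k x - u x) (\<lambda>x. w k x - u x) * B v v) \<longlonglongrightarrow> 0"
        using tendsto_mult_right[OF lim, of "B v v"] by simp
      have "B (\<lambda>x. w k x - u x) v = B (w k) v - B u v" for k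
        using lin[OF wX u v, of 1 k "-1"] by simp
      then show "\<forall>\<^sub>F k in sequentially. (B (w k) v - B u v)\<^sup>2
          \<le> B (\<lambda>x. w k x - u x) (\<lambda>x. w k x - u x) * B v v"
        using CS[OF diff v] by (intro always_eventually allI) metis
    qed auto
    then have "(\<lambda>k. sqrt ((B (w k) v - B u v)\<^sup>2)) \<longlonglongrightarrow> sqrt 0"
      by (intro tendsto_intros)
    then have "(\<lambda>k. B (w k) v - B u v) \<longlonglongrightarrow> 0"
      by (simp add: tendsto_rabs_zero_iff)
    then have Bw: "(\<lambda>k. B (w k) v) \<longlonglongrightarrow> B u v"
      by (simp add: LIM_zero_iff)
    \<comment> \<open>\<open>w k + t v\<close> is a competitor; in the limit the error \<open>(1/4)^k / 4\<close> of near-minimality disappears\<close>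
    have "0 \<le> 0 + 2 * t * (B u v - F v) + t\<^sup>2 * B v v" for t
    proof (rule LIMSEQ_le_const)
      have "(\<lambda>k::nat. (1/4::real)^k / 4) \<longlonglongrightarrow> 0"
        by (auto intro!: tendsto_eq_intros LIMSEQ_realpow_zero)
      then show "(\<lambda>k. (1/4::real)^k / 4 + 2 * t * (B (w k) v - F v) + t\<^sup>2 * B v v)
          \<longlonglongrightarrow> 0 + 2 * t * (B u v - F v) + t\<^sup>2 * B v v"
        by (intro tendsto_intros Bw)
      have "0 \<le> (1/4::real)^k / 4 + 2 * t * (B (w k) v - F v) + t\<^sup>2 * B v v" for k
      proof -
        have "m \<le> J (\<lambda>x. 1 * w k x + t * v x)" using m comb[OF wX v] by blast
        also have "\<dots> = J (w k) + 2 * t * (B (w k) v - F v) + t\<^sup>2 * B v v"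
          unfolding J_def expand[OF wX v] linF[OF wX v] by (simp add: algebra_simps)
        finally show ?thesis using wm[of k] by simp
      qed
      then show "\<exists>N. \<forall>k\<ge>N. 0 \<le> (1/4::real)^k / 4 + 2 * t * (B (w k) v - F v) + t\<^sup>2 * B v v"
        by blast
    qed
    then have "(B u v - F v)\<^sup>2 \<le> 0 * B v v" by (rule nonneg_quadratic_discriminant)
    then show ?thesis by simp
  qed
  with u show ?thesis by blast
qed

section \<open>Lebesgue measure on products\<close>

lemma AE_lebesgue_on:
  assumes "AE x in lebesgue. P x" "S \<in> sets lebesgue"
  shows "AE x in lebesgue_on S. P x"
  using assms by (subst AE_restrict_space_iff) (auto elim: eventually_mono)

text \<open>
  Lebesgue measure on a product is the completion of a product measure and not itself a product measure.
  The lemmas below transfer null sets, measurability and Tonelli's theorem from the Borel measures by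
  Borel modifications on null sets.
\<close>

lemma AE_lebesgue_fst:
  assumes "AE x::'a::euclidean_space in lebesgue. P x"
  shows "AE z::'a \<times> 'b::euclidean_space in lebesgue. P (fst z)"
proof -
  obtain N where N: "{x. \<not> P x} \<subseteq> N" "emeasure lborel N = 0" "N \<in> sets lborel"
    using assms unfolding AE_completion_iff by (auto elim: AE_E)
  have "emeasure (lborel \<Otimes>\<^sub>M lborel) (N \<times> (UNIV :: 'b set)) = 0"
    using N by (subst lborel.emeasure_pair_measure_Times) auto
  then have "AE z::'a \<times> 'b in lborel. P (fst z)"
    using N unfolding lborel_prod by (intro AE_I[of _ _ "N \<times> UNIV"]) (auto intro: borel_Times)
  then show ?thesis by (rule AE_completion)
qed

lemma AE_lebesgue_snd:
  assumes "AE y::'b::euclidean_space in lebesgue. P y"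
  shows "AE z::'a::euclidean_space \<times> 'b in lebesgue. P (snd z)"
proof -
  obtain N where N: "{x. \<not> P x} \<subseteq> N" "emeasure lborel N = 0" "N \<in> sets lborel"
    using assms unfolding AE_completion_iff by (auto elim: AE_E)
  have "emeasure (lborel \<Otimes>\<^sub>M lborel) ((UNIV :: 'a set) \<times> N) = 0"
    using N by (subst lborel.emeasure_pair_measure_Times) auto
  then have "AE z::'a \<times> 'b in lborel. P (snd z)"
    using N unfolding lborel_prod by (intro AE_I[of _ _ "UNIV \<times> N"]) (auto intro: borel_Times)
  then show ?thesis by (rule AE_completion)
qed

lemma borel_measurable_lebesgue_fst:
  fixes u :: "'a::euclidean_space \<Rightarrow> real"
  assumes "u \<in> borel_measurable lebesgue"
  shows "(\<lambda>z::'a \<times> 'b::euclidean_space. u (fst z)) \<in> borel_measurable lebesgue"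
proof -
  obtain u' where u': "u' \<in> borel_measurable lborel" "AE x in lborel. u x = u' x"
    using completion_ex_borel_measurable_real[OF assms] by auto
  have "(\<lambda>z::'a \<times> 'b. u' (fst z)) \<in> borel_measurable lborel"
    using u'(1) unfolding lborel_prod[symmetric] by measurable
  then have "(\<lambda>z::'a \<times> 'b. u' (fst z)) \<in> borel_measurable lebesgue"
    by (rule measurable_completion)
  moreover have "AE z::'a \<times> 'b in lebesgue. u' (fst z) = u (fst z)"
    using u'(2) by (intro AE_lebesgue_fst AE_completion) (auto elim: eventually_mono)
  ultimately show ?thesis by (rule borel_measurable_AE)
qed

lemma borel_measurable_lebesgue_snd:
  fixes u :: "'b::euclidean_space \<Rightarrow> real"
  assumes "u \<in> borel_measurable lebesgue"
  shows "(\<lambda>z::'a::euclidean_space \<times> 'b. u (snd z)) \<in> borel_measurable lebesgue"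
proof -
  obtain u' where u': "u' \<in> borel_measurable lborel" "AE x in lborel. u x = u' x"
    using completion_ex_borel_measurable_real[OF assms] by auto
  have "(\<lambda>z::'a \<times> 'b. u' (snd z)) \<in> borel_measurable lborel"
    using u'(1) unfolding lborel_prod[symmetric] by measurable
  then have "(\<lambda>z::'a \<times> 'b. u' (snd z)) \<in> borel_measurable lebesgue"
    by (rule measurable_completion)
  moreover have "AE z::'a \<times> 'b in lebesgue. u' (snd z) = u (snd z)"
    using u'(2) by (intro AE_lebesgue_snd AE_completion) (auto elim: eventually_mono)
  ultimately show ?thesis by (rule borel_measurable_AE)
qed

lemma nn_integral_lebesgue_prod:
  fixes F :: "'a::euclidean_space \<times> 'b::euclidean_space \<Rightarrow> ennreal"
  assumes "F \<in> borel_measurable lebesgue"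
  shows "(\<integral>\<^sup>+z. F z \<partial>lebesgue) = (\<integral>\<^sup>+x. \<integral>\<^sup>+y. F (x, y) \<partial>lebesgue \<partial>lebesgue)"
proof -
  obtain F' where F': "F' \<in> borel_measurable lborel" "AE z in lborel. F z = F' z"
    using completion_ex_borel_measurable[OF assms] by auto
  have F'm: "F' \<in> borel_measurable (lborel \<Otimes>\<^sub>M lborel)"
    using F'(1) by (simp add: lborel_prod)
  have ae: "AE z in lborel \<Otimes>\<^sub>M lborel. F z = F' z"
    using F'(2) unfolding lborel_prod .
  have "(\<integral>\<^sup>+z. F z \<partial>lebesgue) = (\<integral>\<^sup>+z. F' z \<partial>(lborel \<Otimes>\<^sub>M lborel))"
    unfolding nn_integral_completion lborel_prod by (rule nn_integral_cong_AE[OF F'(2)])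
  also have "\<dots> = (\<integral>\<^sup>+x. \<integral>\<^sup>+y. F' (x, y) \<partial>lborel \<partial>lborel)"
    using F'm by (rule lborel.nn_integral_fst[symmetric])
  also have "\<dots> = (\<integral>\<^sup>+x. \<integral>\<^sup>+y. F (x, y) \<partial>lborel \<partial>lborel)"
    by (rule nn_integral_cong_AE)
       (use lborel_pair.AE_pair[OF ae] in \<open>auto elim!: eventually_mono intro!: nn_integral_cong_AE\<close>)
  finally show ?thesis by (simp add: nn_integral_completion)
qed

lemma nn_integral_lebesgue_tensor:
  fixes a :: "'a::euclidean_space \<Rightarrow> real" and b :: "'b::euclidean_space \<Rightarrow> real"
  assumes a: "a \<in> borel_measurable lebesgue" "\<And>x. 0 \<le> a x"
    and b: "b \<in> borel_measurable lebesgue" "\<And>y. 0 \<le> b y"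
  shows "(\<integral>\<^sup>+z. ennreal (a (fst z) * b (snd z)) \<partial>lebesgue)
    = (\<integral>\<^sup>+x. ennreal (a x) \<partial>lebesgue) * (\<integral>\<^sup>+y. ennreal (b y) \<partial>lebesgue)"
proof -
  have [measurable]: "(\<lambda>z::'a\<times>'b. a (fst z)) \<in> borel_measurable lebesgue"
    "(\<lambda>z::'a\<times>'b. b (snd z)) \<in> borel_measurable lebesgue"
    using a b by (auto intro: borel_measurable_lebesgue_fst borel_measurable_lebesgue_snd)
  have "(\<lambda>z::'a\<times>'b. a (fst z) * b (snd z)) \<in> borel_measurable lebesgue" by measurable
  then have "(\<integral>\<^sup>+z. ennreal (a (fst z) * b (snd z)) \<partial>lebesgue)
      = (\<integral>\<^sup>+x. \<integral>\<^sup>+y. ennreal (a x) * ennreal (b y) \<partial>lebesgue \<partial>lebesgue)"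
    by (subst nn_integral_lebesgue_prod) (auto simp: ennreal_mult a b)
  then show ?thesis
    using a(1) b(1) by (simp add: nn_integral_cmult nn_integral_multc)
qed

lemma
  fixes a :: "'a::euclidean_space \<Rightarrow> real" and b :: "'b::euclidean_space \<Rightarrow> real"
  assumes a: "integrable lebesgue a" "\<And>x. 0 \<le> a x" and b: "integrable lebesgue b" "\<And>y. 0 \<le> b y"
  shows integrable_lebesgue_tensor: "integrable lebesgue (\<lambda>z. a (fst z) * b (snd z))"
    and integral_lebesgue_tensor:
      "(LINT z|lebesgue. a (fst z) * b (snd z)) = (LINT x|lebesgue. a x) * (LINT y|lebesgue. b y)"
proof -
  have [measurable]: "(\<lambda>z::'a\<times>'b. a (fst z)) \<in> borel_measurable lebesgue"
    "(\<lambda>z::'a\<times>'b. b (snd z)) \<in> borel_measurable lebesgue"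
    using a b by (auto intro: borel_measurable_lebesgue_fst borel_measurable_lebesgue_snd)
  have m: "(\<lambda>z::'a\<times>'b. a (fst z) * b (snd z)) \<in> borel_measurable lebesgue" by measurable
  have nn: "(\<integral>\<^sup>+z. ennreal (a (fst z) * b (snd z)) \<partial>lebesgue)
      = ennreal ((LINT x|lebesgue. a x) * (LINT y|lebesgue. b y))"
    using a b by (subst nn_integral_lebesgue_tensor) (auto simp: nn_integral_eq_integral ennreal_mult)
  show i: "integrable lebesgue (\<lambda>z. a (fst z) * b (snd z))"
    using m nn by (intro integrableI_bounded) (auto simp: a b)
  show "(LINT z|lebesgue. a (fst z) * b (snd z)) = (LINT x|lebesgue. a x) * (LINT y|lebesgue. b y)"
    using nn nn_integral_eq_integral[OF i] by (simp add: a b)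
qed

section \<open>The polynomial weights\<close>

lemma weight_ge_1: "1 \<le> weight \<gamma> x"
  by (simp add: weight_def)

lemma weight_pos: "0 < weight \<gamma> x"
  using weight_ge_1[of \<gamma> x] by linarith

lemma borel_measurable_weight [measurable]: "weight \<gamma> \<in> borel_measurable borel"
  unfolding weight_def by measurable

text \<open>
  On the dyadic shell \<open>2^k \<le> |x| < 2^(k+1)\<close>, of measure at most a multiple of \<open>2^(k d)\<close>, the inverse weight
  is at most \<open>2^(-k (d + 2 \<gamma>))\<close>; the products form a geometric series of ratio \<open>2^(-2 \<gamma>)\<close>.
\<close>

lemma integrable_inverse_weight:
  assumes "0 < \<gamma>"
  shows "integrable lebesgue (\<lambda>x::'a::euclidean_space. 1 / weight \<gamma> x)"
proof -
  define d where "d = DIM('a)"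
  define p where "p = real d + 2 * \<gamma>"
  define V where "V = measure lborel (ball (0::'a) 1)"
  define f where "f k x = indicat_real (ball (0::'a) (2^(Suc k))) x * 2 powr (- (real k * p))" for k x
  have f0: "0 \<le> f k x" for k x by (simp add: f_def)
  have le: "ennreal (1 / weight \<gamma> x) \<le> (\<Sum>k. ennreal (f k x))" for x
  proof -
    have "\<exists>k. 1 / weight \<gamma> x \<le> f k x"
    proof (cases "norm x < 1")
      case True
      then show ?thesis using weight_ge_1[of \<gamma> x] by (intro exI[of _ 0]) (auto simp: f_def)
    next
      case False
      \<comment> \<open>the index of the dyadic shell containing \<open>x\<close>\<close>
      define k where "k = nat \<lfloor>log 2 (norm x)\<rfloor>"
      have nx: "norm x > 0" using False by linarith
      have l0: "0 \<le> log 2 (norm x)" using False nx by (subst zero_le_log_cancel_iff) auto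
      have k: "real k \<le> log 2 (norm x)" "log 2 (norm x) < real (Suc k)"
        using l0 by (auto simp: k_def) linarith+
      have "2 powr real k \<le> norm x" using k(1) nx by (simp add: le_log_iff)
      moreover have "norm x < 2 powr real (Suc k)" using k(2) nx by (simp add: log_less_iff)
      ultimately have k2: "2 powr real k \<le> norm x" "norm x < 2^Suc k"
        by (auto simp: powr_realpow simp del: of_nat_Suc power_Suc)
      have "0 \<le> p" using assms by (simp add: p_def)
      then have "2 powr (real k * p) \<le> norm x powr p"
        using k2(1) by (simp add: powr_powr[symmetric] powr_mono2)
      also have "\<dots> \<le> weight \<gamma> x" by (simp add: weight_def p_def d_def)
      finally have "1 / weight \<gamma> x \<le> 1 / 2 powr (real k * p)"
        by (intro divide_left_mono) (auto intro: mult_pos_pos weight_pos)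
      then show ?thesis using k2(2) by (intro exI[of _ k]) (simp add: f_def powr_minus_divide)
    qed
    then obtain k where "1 / weight \<gamma> x \<le> f k x" by blast
    then have "ennreal (1 / weight \<gamma> x) \<le> ennreal (f k x)" by (rule ennreal_leI)
    also have "\<dots> \<le> (\<Sum>k. ennreal (f k x))"
      using sum_le_suminf[of "\<lambda>k. ennreal (f k x)" "{k}"] by simp
    finally show ?thesis .
  qed
  have int: "(\<integral>\<^sup>+x. ennreal (f k x) \<partial>lborel) = ennreal (V * 2^d * (2 powr (- (2 * \<gamma>)))^k)" for k
  proof -
    have "(\<integral>\<^sup>+x. ennreal (f k x) \<partial>lborel)
        = emeasure lborel (ball (0::'a) (2^(Suc k))) * ennreal (2 powr (- (real k * p)))"
    proof -
      define S where "S = ball (0::'a) (2 ^ Suc k)"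
      have [simp, measurable]: "S \<in> sets borel" by (simp add: S_def)
      show ?thesis
        unfolding f_def S_def[symmetric] by (simp add: ennreal_mult ennreal_indicator nn_integral_multc)
    qed
    also have "emeasure lborel (ball (0::'a) (2^(Suc k))) = ennreal (measure lborel (ball (0::'a) (2^(Suc k))))"
      using emeasure_lborel_ball_finite[of "0::'a" "2^(Suc k)"] by (intro emeasure_eq_ennreal_measure) auto
    also have "measure lborel (ball (0::'a) (2^(Suc k))) = (2^Suc k)^d * V"
      unfolding V_def d_def by (rule content_ball_conv_unit_ball) simp
    finally have "(\<integral>\<^sup>+x. ennreal (f k x) \<partial>lborel) = ennreal ((2^Suc k)^d * V * 2 powr (- (real k * p)))"
      by (simp add: ennreal_mult V_def)
    moreover have "(2^Suc k)^d * 2 powr (- (real k * p)) = 2^d * (2 powr (- (2 * \<gamma>)))^k"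
    proof -
      have "(2^Suc k)^d = (2::real) powr (real (Suc k) * real d)"
        by (simp add: powr_realpow[symmetric] powr_powr del: of_nat_Suc power_Suc)
      moreover have "(2::real)^d = 2 powr (real d)" by (simp add: powr_realpow)
      moreover have "(2 powr (- (2 * \<gamma>)))^k = (2::real) powr (- (2 * \<gamma>) * real k)"
        by (simp add: powr_realpow[symmetric] powr_powr)
      ultimately show ?thesis by (simp add: powr_add[symmetric] p_def algebra_simps)
    qed
    ultimately show ?thesis by (simp only: mult_ac)
  qed
  have q: "norm (2 powr (- (2 * \<gamma>)) :: real) < 1"
    using assms powr_less_mono[of "- (2*\<gamma>)" 0 2] by simp
  have "(\<integral>\<^sup>+x. ennreal (1 / weight \<gamma> (x::'a)) \<partial>lborel) \<le> (\<integral>\<^sup>+x. (\<Sum>k. ennreal (f k x)) \<partial>lborel)"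
    by (intro nn_integral_mono le)
  also have "\<dots> = (\<Sum>k. \<integral>\<^sup>+x. ennreal (f k x) \<partial>lborel)"
    unfolding f_def
    by (intro nn_integral_suminf measurable_compose[OF _ measurable_ennreal] borel_measurable_times
        borel_measurable_indicator borel_measurable_const) (simp add: borel_open)
  also have "\<dots> = ennreal (\<Sum>k. V * 2^d * (2 powr (- (2 * \<gamma>)))^k)"
    unfolding int by (intro suminf_ennreal2 summable_mult summable_geometric q) (simp add: V_def)
  finally have "(\<integral>\<^sup>+x. ennreal (1 / weight \<gamma> (x::'a)) \<partial>lborel) < \<infinity>"
    by (rule le_less_trans) simp
  moreover have "(\<lambda>x::'a. 1 / weight \<gamma> x) \<in> borel_measurable lebesgue"
    by (intro measurable_completion) simp
  ultimately show ?thesis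
    by (intro integrableI_bounded) (simp_all add: weight_pos less_imp_le nn_integral_completion)
qed

lemma weight_le_weight:
  assumes "\<gamma> \<le> \<delta>" "0 \<le> real DIM('a) + 2 * \<gamma>"
  shows "weight \<gamma> (x::'a::euclidean_space) \<le> 2 * weight \<delta> x"
proof (cases "norm x \<le> 1")
  case True
  then have "norm x powr (real DIM('a) + 2 * \<gamma>) \<le> 1"
    using assms by (intro powr_le1) auto
  then show ?thesis by (simp add: weight_def add_increasing2)
next
  case False
  then have "norm x powr (real DIM('a) + 2 * \<gamma>) \<le> norm x powr (real DIM('a) + 2 * \<delta>)"
    using assms by (intro powr_mono) auto
  moreover have "0 \<le> norm x powr (real DIM('a) + 2 * \<delta>)" by simp
  moreover have "1 + a \<le> 2 * (1 + b)" if "a \<le> b" "0 \<le> b" for a b :: real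
    using that by simp
  ultimately show ?thesis unfolding weight_def by blast
qed

lemma norm_diff_powr_le_weight:
  fixes x y :: "'a::euclidean_space"
  assumes "norm x \<le> R" "1 \<le> R" "0 \<le> real DIM('a) + 2 * \<gamma>"
  shows "norm (x - y) powr (real DIM('a) + 2 * \<gamma>) \<le> (2 * R) powr (real DIM('a) + 2 * \<gamma>) * weight \<gamma> y"
proof -
  let ?p = "real DIM('a) + 2 * \<gamma>"
  have "norm (x - y) \<le> R + norm y"
    using norm_triangle_ineq4[of x y] assms(1) by linarith
  also have "\<dots> \<le> 2 * R * max 1 (norm y)"
  proof -
    have "R * 1 \<le> R * max 1 (norm y)" using assms(2) by (intro mult_left_mono) auto
    moreover have "1 * norm y \<le> R * max 1 (norm y)" using assms(2) by (intro mult_mono) auto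
    ultimately show ?thesis by linarith
  qed
  finally have "norm (x - y) powr ?p \<le> (2 * R * max 1 (norm y)) powr ?p"
    using assms(3) by (intro powr_mono2) auto
  also have "\<dots> = (2 * R) powr ?p * max 1 (norm y) powr ?p"
    using assms(2) by (simp add: powr_mult)
  also have "max 1 (norm y) powr ?p \<le> weight \<gamma> y"
    by (auto simp: max_def weight_def)
  finally show ?thesis by (simp add: mult_left_mono)
qed

text \<open>
  Cauchy--Schwarz after splitting \<open>g v\<close> as \<open>(g \<surd>w) (v / \<surd>w)\<close> with \<open>w = weight \<gamma>\<close>.
\<close>

lemma L2w_dual_pairing:
  fixes A :: "'a::euclidean_space set"
  assumes g: "g \<in> L2w_dual_space \<gamma> A" and A: "A \<in> sets lebesgue"
    and v: "v \<in> borel_measurable lebesgue" "integrable lebesgue (\<lambda>x. (v x)\<^sup>2 / weight \<gamma> x)"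
  shows "integrable (lebesgue_on A) (\<lambda>x. g x * v x)"
    and "(L2_inner A g v)\<^sup>2 \<le> (L2w_dual_norm \<gamma> A g)\<^sup>2 * (LINT x|lebesgue. (v x)\<^sup>2 / weight \<gamma> x)"
proof -
  let ?M = "lebesgue_on A"
  have [measurable]: "v \<in> borel_measurable ?M" "g \<in> borel_measurable ?M"
    using v g by (auto simp: L2w_dual_space_def intro: measurable_restrict_space1)
  have [measurable]: "(weight \<gamma> :: 'a \<Rightarrow> real) \<in> borel_measurable ?M"
    by (intro measurable_restrict_space1 measurable_completion) simp
  have w0: "weight \<gamma> x \<noteq> 0" "0 \<le> weight \<gamma> x" for x :: 'a
    using weight_pos[of \<gamma> x] by auto
  have iv: "integrable ?M (\<lambda>x. (v x)\<^sup>2 / weight \<gamma> x)"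
    using integrable_mult_indicator[OF A v(2)] A by (simp add: integrable_restrict_space)
  have gg: "(\<lambda>x. g x * sqrt (weight \<gamma> x)) \<in> square_integrable ?M"
    using g by (auto simp: square_integrable_def L2w_dual_space_def power_mult_distrib w0)
  have vv: "(\<lambda>x. v x / sqrt (weight \<gamma> x)) \<in> square_integrable ?M"
    using iv by (auto simp: square_integrable_def power_divide w0)
  have gv: "(\<lambda>x. g x * sqrt (weight \<gamma> x) * (v x / sqrt (weight \<gamma> x))) = (\<lambda>x. g x * v x)"
    using w0 by auto
  show "integrable ?M (\<lambda>x. g x * v x)"
    using square_integrable_mult[OF gg vv] by (simp only: gv)
  have "(L2_inner A g v)\<^sup>2 \<le> (LINT x|?M. (g x * sqrt (weight \<gamma> x))\<^sup>2) * (LINT x|?M. (v x / sqrt (weight \<gamma> x))\<^sup>2)"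
    using square_integrable_Cauchy_Schwarz[OF gg vv] by (simp only: gv L2_inner_def)
  also have "(LINT x|?M. (g x * sqrt (weight \<gamma> x))\<^sup>2) = (L2w_dual_norm \<gamma> A g)\<^sup>2"
    by (simp add: L2w_dual_norm_def power_mult_distrib w0)
  also have "(LINT x|?M. (v x / sqrt (weight \<gamma> x))\<^sup>2) \<le> (LINT x|lebesgue. (v x)\<^sup>2 / weight \<gamma> x)"
  proof -
    have "(LINT x|?M. (v x / sqrt (weight \<gamma> x))\<^sup>2) = (LINT x|lebesgue. indicator A x *\<^sub>R ((v x)\<^sup>2 / weight \<gamma> x))"
      using A by (simp add: power_divide w0 integral_restrict_space)
    also have "\<dots> \<le> (LINT x|lebesgue. (v x)\<^sup>2 / weight \<gamma> x)"
      using v(2) A w0 by (intro integral_mono integrable_mult_indicator) (auto simp: indicator_def)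
    finally show ?thesis .
  qed
  finally show "(L2_inner A g v)\<^sup>2 \<le> (L2w_dual_norm \<gamma> A g)\<^sup>2 * (LINT x|lebesgue. (v x)\<^sup>2 / weight \<gamma> x)"
    by (simp add: mult_left_mono)
qed

section \<open>The energy space\<close>

lemma frac_const_pos: "0 < s \<Longrightarrow> s < 1 \<Longrightarrow> 0 < frac_const d s"
  unfolding frac_const_def by (intro divide_pos_pos mult_pos_pos Gamma_real_pos) auto

lemma exterior_measurable [measurable]: "exterior \<Omega> \<in> sets lebesgue"
  by (simp add: exterior_def)

lemma closed_X_domain: "closed (X_domain \<Omega>)"
  unfolding X_domain_def exterior_def Compl_eq_Diff_UNIV[symmetric]
  by (intro closed_Compl open_Times open_Compl closed_closure)

lemma X_domain_measurable [measurable]: "X_domain \<Omega> \<in> sets lebesgue"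
  using closed_X_domain[of \<Omega>] by (intro sets_completionI_sets) (simp add: borel_closed)

text \<open>
  Dividing by the square root of the kernel's denominator makes the bilinear form \<open>\<langle>u, v\<rangle>\<^sub>X\<close> an \<open>L\<^sup>2\<close>
  inner product of difference quotients, so that everything known about \<open>square_integrable\<close> applies to it.
\<close>

definition slope :: "real \<Rightarrow> ('a::euclidean_space \<Rightarrow> real) \<Rightarrow> 'a \<times> 'a \<Rightarrow> real" where
  "slope s u z = (u (fst z) - u (snd z)) / norm (fst z - snd z) powr ((real DIM('a) + 2 * s) / 2)"

lemma X_integrand_eq_slope: "X_integrand s u v z = slope s u z * slope s v z"
  by (cases z) (simp add: X_integrand_def slope_def powr_add[symmetric])

lemma slope_lincomb: "slope s (\<lambda>x. a * u x + b * v x) = (\<lambda>z. a * slope s u z + b * slope s v z)"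
  by (auto simp: slope_def algebra_simps add_divide_distrib diff_divide_distrib)

lemma slope_measurable:
  fixes u :: "'a::euclidean_space \<Rightarrow> real"
  assumes "u \<in> borel_measurable lebesgue"
  shows "slope s u \<in> borel_measurable lebesgue"
proof -
  have "(\<lambda>z::'a\<times>'a. norm (fst z - snd z) powr ((real DIM('a) + 2 * s) / 2)) \<in> borel_measurable borel"
    unfolding borel_prod[symmetric] by measurable
  then have "(\<lambda>z::'a\<times>'a. norm (fst z - snd z) powr ((real DIM('a) + 2 * s) / 2)) \<in> borel_measurable lebesgue"
    by (intro measurable_completion) simp
  then show ?thesis
    unfolding slope_def
    by (intro borel_measurable_divide borel_measurable_diff
        borel_measurable_lebesgue_fst borel_measurable_lebesgue_snd assms)
qed

lemma V_space_iff:
  "v \<in> V_space s \<Omega> \<longleftrightarrow> v \<in> borel_measurable lebesgue \<and> v \<in> square_integrable (lebesgue_on \<Omega>)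
    \<and> slope s v \<in> square_integrable (lebesgue_on (X_domain \<Omega>))"
proof -
  have "X_integrand s v v = (\<lambda>z. (slope s v z)\<^sup>2)"
    by (auto simp: X_integrand_eq_slope power2_eq_square)
  then show ?thesis
    by (auto simp: V_space_def square_integrable_def intro: measurable_restrict_space1 slope_measurable)
qed

lemma V_space_lincomb:
  "u \<in> V_space s \<Omega> \<Longrightarrow> v \<in> V_space s \<Omega> \<Longrightarrow> (\<lambda>x. a * u x + b * v x) \<in> V_space s \<Omega>"
  by (auto simp: V_space_iff slope_lincomb intro!: square_integrable_lincomb)

lemma V_space_diff:
  "u \<in> V_space s \<Omega> \<Longrightarrow> v \<in> V_space s \<Omega> \<Longrightarrow> (\<lambda>x. u x - v x) \<in> V_space s \<Omega>"
  using V_space_lincomb[of u s \<Omega> v 1 "-1"] by simp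

lemma X_inner_eq_slope:
  "X_inner s \<Omega> u v = frac_const DIM('a) s / 2 * (LINT z|lebesgue_on (X_domain \<Omega>). slope s u z * slope s v z)"
  for \<Omega> :: "'a::euclidean_space set"
  by (simp add: X_inner_def X_integrand_eq_slope)

lemma L2_inner_self_nonneg: "0 \<le> L2_inner A v v"
  by (simp add: L2_inner_def)

lemma X_inner_self_nonneg: "0 < s \<Longrightarrow> s < 1 \<Longrightarrow> 0 \<le> X_inner s \<Omega> v v"
  for \<Omega> :: "'a::euclidean_space set"
  using frac_const_pos[of s "DIM('a)"]
  by (simp add: X_inner_eq_slope)

lemma V_norm_power2:
  "0 < s \<Longrightarrow> s < 1 \<Longrightarrow> (V_norm s \<Omega> v)\<^sup>2 = L2_inner \<Omega> v v + X_inner s \<Omega> v v"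
  by (simp add: V_norm_def L2_norm_def X_norm_def L2_inner_self_nonneg X_inner_self_nonneg)

lemma V_norm_nonneg: "0 \<le> V_norm s \<Omega> v"
  by (simp add: V_norm_def)

definition energy_form ::
    "real \<Rightarrow> real \<Rightarrow> 'a::euclidean_space set \<Rightarrow> ('a \<Rightarrow> real) \<Rightarrow> ('a \<Rightarrow> real) \<Rightarrow> real" where
  "energy_form s \<alpha> \<Omega> u v = X_inner s \<Omega> u v + \<alpha> * L2_inner \<Omega> u v"

lemma energy_form_sym: "energy_form s \<alpha> \<Omega> u v = energy_form s \<alpha> \<Omega> v u"
  by (simp add: energy_form_def X_inner_eq_slope L2_inner_def mult.commute)

lemma energy_form_lincomb:
  assumes "u \<in> V_space s \<Omega>" "v \<in> V_space s \<Omega>" "w \<in> V_space s \<Omega>"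
  shows "energy_form s \<alpha> \<Omega> (\<lambda>x. a * u x + b * v x) w =
    a * energy_form s \<alpha> \<Omega> u w + b * energy_form s \<alpha> \<Omega> v w"
  using assms
  by (simp add: energy_form_def X_inner_eq_slope L2_inner_def slope_lincomb V_space_iff
      integral_mult_lincomb) (simp add: field_simps)

lemma energy_form_nonneg: "0 < s \<Longrightarrow> s < 1 \<Longrightarrow> 0 < \<alpha> \<Longrightarrow> 0 \<le> energy_form s \<alpha> \<Omega> v v"
  by (simp add: energy_form_def L2_inner_self_nonneg X_inner_self_nonneg)

lemma V_norm_power2_le_energy_form:
  assumes "0 < s" "s < 1" "0 < \<alpha>"
  shows "(V_norm s \<Omega> v)\<^sup>2 \<le> (1 + 1 / \<alpha>) * energy_form s \<alpha> \<Omega> v v"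
proof -
  have "0 \<le> \<alpha> * L2_inner \<Omega> v v + X_inner s \<Omega> v v / \<alpha>"
    using assms by (simp add: L2_inner_self_nonneg X_inner_self_nonneg)
  then show ?thesis
    using assms by (simp add: V_norm_power2 energy_form_def field_simps)
qed

text \<open>
  The inequality \<open>v(y)\<^sup>2 \<le> 2 v(x)\<^sup>2 + 2 (v(x) - v(y))\<^sup>2\<close>, divided by \<open>weight s y\<close>, is integrated over
  \<open>x \<in> \<Omega>\<close> and all \<open>y\<close>. The left side gives the measure of \<open>\<Omega>\<close> times the weighted norm. On the right,
  the first term is finite because \<open>1 / weight s\<close> is integrable, and the second is dominated by the
  energy because \<open>|x - y|^(d + 2s)\<close> is at most a multiple of \<open>weight s y\<close> for \<open>x\<close> in a bounded set.
\<close>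

lemma L2w_bound_by_V_norm:
  fixes \<Omega> :: "'a::euclidean_space set"
  assumes \<Omega>: "open \<Omega>" "bounded \<Omega>" "\<Omega> \<noteq> {}" and s: "0 < s" "s < 1"
  shows "\<exists>C>0. \<forall>v\<in>V_space s \<Omega>. integrable lebesgue (\<lambda>y. (v y)\<^sup>2 / weight s y)
    \<and> (LINT y|lebesgue. (v y)\<^sup>2 / weight s y) \<le> C * (V_norm s \<Omega> v)\<^sup>2"
proof -
  define p where "p = real DIM('a) + 2 * s"
  define c where "c = frac_const DIM('a) s"
  have c: "0 < c" using s by (simp add: c_def frac_const_pos)
  obtain R where R: "1 \<le> R" "\<And>x. x \<in> \<Omega> \<Longrightarrow> norm x \<le> R"
    using \<Omega>(2) by (metis bounded_pos max.cobounded1 max.coboundedI2)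
  define W where "W = (LINT y::'a|lebesgue. 1 / weight s y)"
  have W: "0 \<le> W" by (simp add: W_def weight_pos less_imp_le)
  define m where "m = measure lebesgue \<Omega>"
  have \<Omega>m: "\<Omega> \<in> lmeasurable" using \<Omega> by (simp add: lmeasurable_open)
  then have \<Omega>s [measurable]: "\<Omega> \<in> sets lebesgue" by auto
  have m: "0 < m"
    using \<Omega> \<Omega>m open_not_negligible[OF \<Omega>(1,3)] negligible_iff_measure[of \<Omega>]
    by (auto simp: m_def zero_less_measure_iff measure_nonneg less_le)
  define k where "k = 2 * (2 * R) powr p"
  have k: "0 < k" using R by (simp add: k_def)
  define C where "C = (2 * W + k * (2 / c)) / m"
  have C: "0 < C" using W k c m by (simp add: C_def add_nonneg_pos)
  \<comment> \<open>the pointwise inequality that is integrated\<close>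
  have pw: "(v y)\<^sup>2 / weight s y \<le> 2 * ((v x)\<^sup>2 * (1 / weight s y)) + k * (slope s v (x, y))\<^sup>2"
    if "x \<in> \<Omega>" for v :: "'a \<Rightarrow> real" and x y
  proof -
    have "0 \<le> p" using s by (simp add: p_def)
    have "(v y)\<^sup>2 \<le> 2 * (v x)\<^sup>2 + 2 * (v x - v y)\<^sup>2"
      using zero_le_power2[of "2 * v x - v y"] by (simp add: power2_eq_square algebra_simps)
    then have "(v y)\<^sup>2 / weight s y \<le> (2 * (v x)\<^sup>2 + 2 * (v x - v y)\<^sup>2) / weight s y"
      using weight_pos[of s y] by (intro divide_right_mono) auto
    also have "\<dots> = 2 * ((v x)\<^sup>2 * (1 / weight s y)) + 2 * ((v x - v y)\<^sup>2 / weight s y)"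
      by (simp add: add_divide_distrib)
    also have "(v x - v y)\<^sup>2 / weight s y \<le> (2 * R) powr p * (slope s v (x, y))\<^sup>2"
    proof (cases "x = y")
      case False
      have sl: "(slope s v (x, y))\<^sup>2 = (v x - v y)\<^sup>2 / norm (x - y) powr p"
        by (simp add: slope_def power_divide p_def power2_eq_square powr_add[symmetric])
      have "norm (x - y) powr p \<le> (2 * R) powr p * weight s y"
        using norm_diff_powr_le_weight[of x R s y] R that s by (simp add: p_def)
      then have "(v x - v y)\<^sup>2 / ((2 * R) powr p * weight s y) \<le> (v x - v y)\<^sup>2 / norm (x - y) powr p"
        using False R weight_pos[of s y] by (intro divide_left_mono) auto
      then show ?thesis using R weight_pos[of s y] by (simp add: sl field_simps)
    qed auto
    finally show ?thesis by (simp add: k_def)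
  qed
  have "integrable lebesgue (\<lambda>y. (v y)\<^sup>2 / weight s y)
    \<and> (LINT y|lebesgue. (v y)\<^sup>2 / weight s y) \<le> C * (V_norm s \<Omega> v)\<^sup>2" if v: "v \<in> V_space s \<Omega>" for v
  proof -
    have [measurable]: "v \<in> borel_measurable lebesgue" using v by (simp add: V_space_iff)
    have [measurable]: "(weight s :: 'a \<Rightarrow> real) \<in> borel_measurable lebesgue"
      by (intro measurable_completion) simp
    define q where "q y = (v y)\<^sup>2 / weight s y" for y
    have q0: "0 \<le> q y" for y by (simp add: q_def weight_pos less_imp_le)
    have [measurable]: "q \<in> borel_measurable lebesgue" unfolding q_def by measurable
    define f1 where "f1 z = (indicator \<Omega> (fst z) * (v (fst z))\<^sup>2) * (1 / weight s (snd z))" for z :: "'a \<times> 'a"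
    define f2 where "f2 z = indicator (X_domain \<Omega>) z *\<^sub>R (slope s v z)\<^sup>2" for z
    have iv: "integrable lebesgue (\<lambda>x. indicator \<Omega> x * (v x)\<^sup>2)"
      and Iv: "(LINT x|lebesgue. indicator \<Omega> x * (v x)\<^sup>2) = L2_inner \<Omega> v v"
      using v by (auto simp: V_space_iff square_integrable_def integrable_restrict_space
          L2_inner_def integral_restrict_space power2_eq_square)
    have if1: "integrable lebesgue f1" and If1: "integral\<^sup>L lebesgue f1 = L2_inner \<Omega> v v * W"
      using integrable_lebesgue_tensor[OF iv _ integrable_inverse_weight[OF s(1)]]
        integral_lebesgue_tensor[OF iv _ integrable_inverse_weight[OF s(1)]]
      by (auto simp: f1_def[abs_def] Iv W_def weight_pos less_imp_le)
    have if2: "integrable lebesgue f2" and If2: "integral\<^sup>L lebesgue f2 = 2 / c * X_inner s \<Omega> v v"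
      using v c by (auto simp: V_space_iff square_integrable_def integrable_restrict_space f2_def[abs_def]
          X_inner_eq_slope integral_restrict_space power2_eq_square c_def[symmetric])
    have "ennreal m * (\<integral>\<^sup>+y. ennreal (q y) \<partial>lebesgue)
        = (\<integral>\<^sup>+x. ennreal (indicator \<Omega> x) \<partial>lebesgue) * (\<integral>\<^sup>+y. ennreal (q y) \<partial>lebesgue)"
      using \<Omega>m by (simp add: ennreal_indicator m_def emeasure_eq_measure2)
    also have "\<dots> = (\<integral>\<^sup>+z. ennreal (indicator \<Omega> (fst z) * q (snd z)) \<partial>lebesgue)"
      by (rule nn_integral_lebesgue_tensor[symmetric]) (auto simp: q0)
    also have "\<dots> \<le> (\<integral>\<^sup>+z. ennreal (2 * f1 z + k * f2 z) \<partial>lebesgue)"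
    proof (intro nn_integral_mono ennreal_leI)
      fix z :: "'a \<times> 'a"
      obtain x y where z: "z = (x, y)" by (cases z)
      show "indicator \<Omega> (fst z) * q (snd z) \<le> 2 * f1 z + k * f2 z"
      proof (cases "x \<in> \<Omega>")
        case True
        then have "(x, y) \<in> X_domain \<Omega>"
          using closure_subset[of \<Omega>] by (auto simp: X_domain_def exterior_def)
        then show ?thesis using pw[OF True, of v y] True by (simp add: z q_def f1_def f2_def)
      qed (use k in \<open>simp add: z f1_def f2_def\<close>)
    qed
    also have "\<dots> = ennreal (2 * (L2_inner \<Omega> v v * W) + k * (2 / c * X_inner s \<Omega> v v))"
    proof (subst nn_integral_eq_integral)
      show "AE z in lebesgue. 0 \<le> 2 * f1 z + k * f2 z"
        using k by (simp add: f1_def f2_def weight_pos less_imp_le)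
    qed (use if1 if2 If1 If2 in simp_all)
    also have "\<dots> \<le> ennreal (m * (C * (V_norm s \<Omega> v)\<^sup>2))"
    proof (rule ennreal_leI)
      have "0 \<le> k * (2 / c) * L2_inner \<Omega> v v" "0 \<le> 2 * W * X_inner s \<Omega> v v"
        using k c W s by (auto simp: L2_inner_self_nonneg X_inner_self_nonneg)
      then have "2 * (L2_inner \<Omega> v v * W) + k * (2 / c * X_inner s \<Omega> v v)
          \<le> (2 * W + k * (2 / c)) * (V_norm s \<Omega> v)\<^sup>2"
        unfolding V_norm_power2[OF s] by (simp add: algebra_simps)
      then show "2 * (L2_inner \<Omega> v v * W) + k * (2 / c * X_inner s \<Omega> v v) \<le> m * (C * (V_norm s \<Omega> v)\<^sup>2)"
        using m by (simp add: C_def)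
    qed
    finally have "ennreal m * (\<integral>\<^sup>+y. ennreal (q y) \<partial>lebesgue) \<le> ennreal m * ennreal (C * (V_norm s \<Omega> v)\<^sup>2)"
      using m C by (simp add: ennreal_mult)
    then have le: "(\<integral>\<^sup>+y. ennreal (q y) \<partial>lebesgue) \<le> ennreal (C * (V_norm s \<Omega> v)\<^sup>2)"
      using m by (simp add: ennreal_mult_le_mult_iff)
    have iq: "integrable lebesgue q"
      using le by (intro integrableI_bounded) (auto simp: q0 le_less_trans[OF _ ennreal_less_top])
    moreover have "integral\<^sup>L lebesgue q \<le> C * (V_norm s \<Omega> v)\<^sup>2"
      using le C by (simp add: nn_integral_eq_integral[OF iq] q0)
    ultimately show ?thesis by (simp add: q_def[abs_def])
  qed
  with C show ?thesis by blast
qed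

section \<open>Existence and uniqueness\<close>

text \<open>
  With \<open>d\<^sub>k\<close> the increments, \<open>\<Sum> 2^k d\<^sub>k\<^sup>2 / \<rho>\<close> has finite integral, so it is finite almost everywhere, and
  \<open>2 |d\<^sub>k| \<le> 2^(-k) + 2^k d\<^sub>k\<^sup>2\<close> makes the increments summable there. Applied with a density \<open>1 / \<rho>\<close> that
  decays at infinity, this yields convergence almost everywhere on the whole space.
\<close>

lemma AE_convergent_of_fast_Cauchy:
  assumes meas [measurable]: "\<And>k. w k \<in> borel_measurable M" "\<rho> \<in> borel_measurable M"
    and \<rho>: "\<And>x. 0 < \<rho> x"
    and int: "\<And>k. integrable M (\<lambda>x. (w (Suc k) x - w k x)\<^sup>2 / \<rho> x)"
    and le: "\<And>k. (LINT x|M. (w (Suc k) x - w k x)\<^sup>2 / \<rho> x) \<le> A * (1/4)^k"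
  shows "AE x in M. convergent (\<lambda>k. w k x :: real)"
proof -
  define d where "d k x = w (Suc k) x - w k x" for k x
  have A: "0 \<le> A"
  proof -
    have "0 \<le> (LINT x|M. (w (Suc 0) x - w 0 x)\<^sup>2 / \<rho> x)" by (simp add: less_imp_le[OF \<rho>])
    also note le[of 0]
    finally show ?thesis by simp
  qed
  have "(\<integral>\<^sup>+x. (\<Sum>k. ennreal (2^k * ((d k x)\<^sup>2 / \<rho> x))) \<partial>M)
      = (\<Sum>k. \<integral>\<^sup>+x. ennreal (2^k * ((d k x)\<^sup>2 / \<rho> x)) \<partial>M)"
    by (rule nn_integral_suminf) (simp add: d_def)
  also have "\<dots> \<le> (\<Sum>k. ennreal (A * (1/2)^k))"
  proof (rule suminf_le)
    fix k
    have "(\<integral>\<^sup>+x. ennreal (2^k * ((d k x)\<^sup>2 / \<rho> x)) \<partial>M) = ennreal (2^k * (LINT x|M. (d k x)\<^sup>2 / \<rho> x))"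
    proof -
      have i: "integrable M (\<lambda>x. (d k x)\<^sup>2 / \<rho> x)" using int[of k] by (simp only: d_def)
      show ?thesis
        unfolding integral_mult_right_zero[symmetric]
        by (rule nn_integral_eq_integral[OF integrable_mult_right[OF i]]) (auto simp: less_imp_le[OF \<rho>])
    qed
    also have "\<dots> \<le> ennreal (2^k * (A * (1/4)^k))"
      using le[of k] by (intro ennreal_leI mult_left_mono) (auto simp: d_def)
    also have "2^k * (A * (1/4)^k) = A * (1/2)^k"
      by (simp add: power_mult_distrib[symmetric] mult.left_commute)
    finally show "(\<integral>\<^sup>+x. ennreal (2^k * ((d k x)\<^sup>2 / \<rho> x)) \<partial>M) \<le> ennreal (A * (1/2)^k)" .
  qed auto
  also have "\<dots> = ennreal (\<Sum>k. A * (1/2)^k)"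
    using A by (intro suminf_ennreal2 summable_mult summable_geometric) auto
  finally have "(\<integral>\<^sup>+x. (\<Sum>k. ennreal (2^k * ((d k x)\<^sup>2 / \<rho> x))) \<partial>M) \<noteq> \<infinity>"
    by (auto simp: top_unique)
  then have "AE x in M. (\<Sum>k. ennreal (2^k * ((d k x)\<^sup>2 / \<rho> x))) \<noteq> \<infinity>"
    by (intro nn_integral_PInf_AE) (auto simp: d_def)
  then show ?thesis
  proof eventually_elim
    case (elim x)
    then have "summable (\<lambda>k. 2^k * ((d k x)\<^sup>2 / \<rho> x))"
      by (intro summable_suminf_not_top) (auto simp: less_imp_le[OF \<rho>])
    then have "summable (\<lambda>k. \<rho> x * (2^k * ((d k x)\<^sup>2 / \<rho> x)))"
      by (rule summable_mult)
    then have "summable (\<lambda>k. 2^k * (d k x)\<^sup>2)"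
      using \<rho>[of x] by simp
    then have sm: "summable (\<lambda>k. (1/2)^k + 2^k * (d k x)\<^sup>2)"
      by (intro summable_add summable_geometric) auto
    have "norm (d k x) \<le> (1/2)^k + 2^k * (d k x)\<^sup>2" for k
    proof -
      \<comment> \<open>expands to \<open>2 |d\<^sub>k| \<le> 2^(-k) + 2^k d\<^sub>k\<^sup>2\<close>\<close>
      have "0 \<le> (1 - 2^k * \<bar>d k x\<bar>)\<^sup>2 / 2^k" by simp
      also have "\<dots> = (1/2)^k + 2^k * (d k x)\<^sup>2 - 2 * \<bar>d k x\<bar>"
        by (simp add: power2_diff power_mult_distrib field_simps power2_eq_square power_one_over)
      finally show ?thesis by simp
    qed
    then have "summable (\<lambda>k. d k x)"
      by (intro summable_comparison_test'[OF sm]) auto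
    then have "convergent (\<lambda>n. \<Sum>k<n. d k x)"
      by (simp add: summable_iff_convergent)
    moreover have "(\<Sum>k<n. d k x) = w n x - w 0 x" for n
      by (induction n) (simp_all add: d_def)
    ultimately show "convergent (\<lambda>n. w n x)"
      using convergent_add[of "\<lambda>n. w n x - w 0 x" "\<lambda>_. w 0 x"] convergent_const[of "w 0 x"] by simp
  qed
qed

text \<open>
  The weighted bound provides a limit \<open>u\<close> almost everywhere, including at points outside \<open>\<Omega>\<close> where
  the \<open>L\<^sup>2(\<Omega>)\<close> part of the norm sees nothing. Fatou's lemma, applied to \<open>w k - w m\<close> as \<open>m\<close> tends to
  infinity, then places \<open>w k - u\<close> in the space and bounds its energy.
\<close>

lemma V_space_complete:
  fixes \<Omega> :: "'a::euclidean_space set"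
  assumes \<Omega>: "open \<Omega>" "bounded \<Omega>" "\<Omega> \<noteq> {}" and s: "0 < s" "s < 1" and \<alpha>: "0 < \<alpha>"
    and w: "\<And>k. w k \<in> V_space s \<Omega>"
    and cauchy: "\<And>k m. k \<le> m \<Longrightarrow>
      energy_form s \<alpha> \<Omega> (\<lambda>x. w k x - w m x) (\<lambda>x. w k x - w m x) \<le> (1/4)^k"
  shows "\<exists>u\<in>V_space s \<Omega>. (\<lambda>k. energy_form s \<alpha> \<Omega> (\<lambda>x. w k x - u x) (\<lambda>x. w k x - u x)) \<longlonglongrightarrow> 0"
proof -
  define c where "c = frac_const DIM('a) s"
  have c: "0 < c" using s by (simp add: c_def frac_const_pos)
  have \<Omega>s [measurable]: "\<Omega> \<in> sets lebesgue" using \<Omega>(1) by (intro sets_completionI_sets) simp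
  have [measurable]: "w k \<in> borel_measurable lebesgue" for k using w by (simp add: V_space_iff)
  obtain C where C: "0 < C" "\<And>v. v \<in> V_space s \<Omega> \<Longrightarrow> integrable lebesgue (\<lambda>y. (v y)\<^sup>2 / weight s y)"
    "\<And>v. v \<in> V_space s \<Omega> \<Longrightarrow> (LINT y|lebesgue. (v y)\<^sup>2 / weight s y) \<le> C * (V_norm s \<Omega> v)\<^sup>2"
    using L2w_bound_by_V_norm[OF \<Omega> s] by blast
  have conv: "AE x in lebesgue. convergent (\<lambda>k. w k x)"
  proof (rule AE_convergent_of_fast_Cauchy)
    show "(weight s :: 'a \<Rightarrow> real) \<in> borel_measurable lebesgue"
      by (intro measurable_completion) simp
    fix k
    have d: "(\<lambda>x. w (Suc k) x - w k x) \<in> V_space s \<Omega>" by (intro V_space_diff w)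
    show "integrable lebesgue (\<lambda>x. (w (Suc k) x - w k x)\<^sup>2 / weight s x)"
      by (rule C(2)[OF d])
    have "(LINT x|lebesgue. (w (Suc k) x - w k x)\<^sup>2 / weight s x)
        = (LINT x|lebesgue. (w k x - w (Suc k) x)\<^sup>2 / weight s x)"
      by (simp add: power2_commute)
    also have "\<dots> \<le> C * (V_norm s \<Omega> (\<lambda>x. w k x - w (Suc k) x))\<^sup>2"
      by (intro C(3) V_space_diff w)
    also have "\<dots> \<le> C * ((1 + 1 / \<alpha>) * energy_form s \<alpha> \<Omega> (\<lambda>x. w k x - w (Suc k) x) (\<lambda>x. w k x - w (Suc k) x))"
      using C(1) V_norm_power2_le_energy_form[OF s \<alpha>] by (intro mult_left_mono) auto
    also have "\<dots> \<le> C * ((1 + 1 / \<alpha>) * (1/4)^k)"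
      using C(1) \<alpha> cauchy[of k "Suc k"] by (intro mult_left_mono) auto
    finally show "(LINT x|lebesgue. (w (Suc k) x - w k x)\<^sup>2 / weight s x) \<le> C * (1 + 1 / \<alpha>) * (1/4)^k"
      by (simp add: mult.assoc)
  qed (auto simp: weight_pos)
  define u where "u x = lim (\<lambda>k. w k x)" for x
  have [measurable]: "u \<in> borel_measurable lebesgue"
    unfolding u_def by (intro borel_measurable_lim_metric) measurable
  have lim: "AE x in lebesgue. (\<lambda>k. w k x) \<longlonglongrightarrow> u x"
    using conv by (auto simp: u_def convergent_LIMSEQ_iff elim: eventually_mono)
  have lim2: "AE z in lebesgue. (\<lambda>k. w k (fst z)) \<longlonglongrightarrow> u (fst z) \<and> (\<lambda>k. w k (snd z)) \<longlonglongrightarrow> u (snd z)"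
    using AE_lebesgue_fst[OF lim] AE_lebesgue_snd[OF lim] by eventually_elim auto
  have key: "(\<lambda>x. w k x - u x) \<in> V_space s \<Omega> \<and>
      energy_form s \<alpha> \<Omega> (\<lambda>x. w k x - u x) (\<lambda>x. w k x - u x) \<le> 2 * (1/4)^k" for k
  proof -
    have dV: "(\<lambda>x. w k x - w m x) \<in> V_space s \<Omega>" for m by (intro V_space_diff w)
    have A: "(LINT x|lebesgue_on \<Omega>. (w k x - w m x)\<^sup>2) \<le> (1/4)^k / \<alpha>"
      and B: "(LINT z|lebesgue_on (X_domain \<Omega>). (slope s (\<lambda>x. w k x - w m x) z)\<^sup>2) \<le> 2 / c * (1/4)^k"
      if "k \<le> m" for m
    proof -
      let ?d = "\<lambda>x. w k x - w m x"
      have "0 \<le> \<alpha> * L2_inner \<Omega> ?d ?d" "0 \<le> X_inner s \<Omega> ?d ?d"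
        using \<alpha> s by (auto simp: L2_inner_self_nonneg X_inner_self_nonneg)
      then have "\<alpha> * L2_inner \<Omega> ?d ?d \<le> (1/4)^k" "X_inner s \<Omega> ?d ?d \<le> (1/4)^k"
        using cauchy[OF that] by (auto simp: energy_form_def)
      then show "(LINT x|lebesgue_on \<Omega>. (?d x)\<^sup>2) \<le> (1/4)^k / \<alpha>"
        "(LINT z|lebesgue_on (X_domain \<Omega>). (slope s ?d z)\<^sup>2) \<le> 2 / c * (1/4)^k"
        using \<alpha> c by (auto simp: L2_inner_def X_inner_eq_slope power2_eq_square c_def[symmetric] field_simps)
    qed
    note F1 = square_integrable_Fatou[where h="\<lambda>m x. w k x - w m x" and l="\<lambda>x. w k x - u x"
        and M="lebesgue_on \<Omega>" and c="(1/4)^k / \<alpha>"]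
    have 1: "(\<lambda>x. w k x - u x) \<in> square_integrable (lebesgue_on \<Omega>)"
      "(LINT x|lebesgue_on \<Omega>. (w k x - u x)\<^sup>2) \<le> (1/4)^k / \<alpha>"
    proof -
      have a: "AE x in lebesgue_on \<Omega>. (\<lambda>m. w k x - w m x) \<longlonglongrightarrow> w k x - u x"
        using AE_lebesgue_on[OF lim \<Omega>s] by eventually_elim (intro tendsto_intros)
      have b: "\<forall>\<^sub>F m in sequentially. (LINT x|lebesgue_on \<Omega>. (w k x - w m x)\<^sup>2) \<le> (1/4)^k / \<alpha>"
        using eventually_ge_at_top[of k] by eventually_elim (rule A)
      have m: "(\<lambda>x. w k x - u x) \<in> borel_measurable (lebesgue_on \<Omega>)"
        by (intro measurable_restrict_space1) measurable
      show "(\<lambda>x. w k x - u x) \<in> square_integrable (lebesgue_on \<Omega>)"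
        "(LINT x|lebesgue_on \<Omega>. (w k x - u x)\<^sup>2) \<le> (1/4)^k / \<alpha>"
        using F1[OF _ m a b] dV by (auto simp: V_space_iff)
    qed
    have 2: "slope s (\<lambda>x. w k x - u x) \<in> square_integrable (lebesgue_on (X_domain \<Omega>))"
      "(LINT z|lebesgue_on (X_domain \<Omega>). (slope s (\<lambda>x. w k x - u x) z)\<^sup>2) \<le> 2 / c * (1/4)^k"
    proof -
      have a: "AE z in lebesgue_on (X_domain \<Omega>).
          (\<lambda>m. slope s (\<lambda>x. w k x - w m x) z) \<longlonglongrightarrow> slope s (\<lambda>x. w k x - u x) z"
        using AE_lebesgue_on[OF lim2 X_domain_measurable]
        unfolding slope_def divide_inverse
        by eventually_elim (intro tendsto_mult tendsto_diff tendsto_const; simp)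
      have b: "\<forall>\<^sub>F m in sequentially.
          (LINT z|lebesgue_on (X_domain \<Omega>). (slope s (\<lambda>x. w k x - w m x) z)\<^sup>2) \<le> 2 / c * (1/4)^k"
        using eventually_ge_at_top[of k] by eventually_elim (rule B)
      have m: "slope s (\<lambda>x. w k x - u x) \<in> borel_measurable (lebesgue_on (X_domain \<Omega>))"
        by (intro measurable_restrict_space1 slope_measurable) measurable
      have d: "slope s (\<lambda>x. w k x - w m x) \<in> square_integrable (lebesgue_on (X_domain \<Omega>))" for m
        using dV by (simp add: V_space_iff)
      show "slope s (\<lambda>x. w k x - u x) \<in> square_integrable (lebesgue_on (X_domain \<Omega>))"
        "(LINT z|lebesgue_on (X_domain \<Omega>). (slope s (\<lambda>x. w k x - u x) z)\<^sup>2) \<le> 2 / c * (1/4)^k"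
        using square_integrable_Fatou[OF d m a b] by auto
    qed
    let ?d = "\<lambda>x. w k x - u x"
    have "\<alpha> * L2_inner \<Omega> ?d ?d \<le> (1/4)^k" "X_inner s \<Omega> ?d ?d \<le> (1/4)^k"
      using 1(2) 2(2) \<alpha> c
      by (auto simp: L2_inner_def X_inner_eq_slope power2_eq_square c_def[symmetric] field_simps)
    then show ?thesis using 1(1) 2(1) by (auto simp: V_space_iff energy_form_def)
  qed
  have uV: "u \<in> V_space s \<Omega>"
    using V_space_diff[OF w[of 0] conjunct1[OF key[of 0]]] by simp
  have "(\<lambda>k. energy_form s \<alpha> \<Omega> (\<lambda>x. w k x - u x) (\<lambda>x. w k x - u x)) \<longlonglongrightarrow> 0"
  proof (rule tendsto_sandwich[OF _ _ tendsto_const])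
    show "(\<lambda>k. 2 * (1/4::real)^k) \<longlonglongrightarrow> 0"
      by (auto intro!: tendsto_eq_intros LIMSEQ_realpow_zero)
  qed (intro always_eventually allI energy_form_nonneg[OF s \<alpha>] conjunct2[OF key])+
  with uV show ?thesis by blast
qed

text \<open>
  Boundedness of the right-hand side is the point to check. Since \<open>weight s \<le> 2 weight (s + \<beta>)\<close>, functions
  of finite energy lie in the weighted space of order \<open>s + \<beta>\<close>, which pairs with the space of \<open>g\<close>.
\<close>

lemma solution_exists:
  fixes \<Omega> :: "'a::euclidean_space set"
  assumes \<Omega>: "open \<Omega>" "bounded \<Omega>" "\<Omega> \<noteq> {}" and s: "0 < s" "s < 1" and \<alpha>: "0 < \<alpha>" and \<beta>: "0 < \<beta>"
    and f: "f \<in> L2_space \<Omega>" and g: "g \<in> L2w_dual_space (s + \<beta>) (exterior \<Omega>)"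
  shows "\<exists>u. solution s \<alpha> \<Omega> f g u"
proof -
  define \<gamma> where "\<gamma> = s + \<beta>"
  have f': "f \<in> square_integrable (lebesgue_on \<Omega>)"
    using f by (simp add: L2_space_def square_integrable_def)
  obtain C where C: "0 < C" "\<And>v. v \<in> V_space s \<Omega> \<Longrightarrow> integrable lebesgue (\<lambda>y. (v y)\<^sup>2 / weight s y)"
    "\<And>v. v \<in> V_space s \<Omega> \<Longrightarrow> (LINT y|lebesgue. (v y)\<^sup>2 / weight s y) \<le> C * (V_norm s \<Omega> v)\<^sup>2"
    using L2w_bound_by_V_norm[OF \<Omega> s] by blast
  have [measurable]: "(weight \<delta> :: 'a \<Rightarrow> real) \<in> borel_measurable lebesgue" for \<delta>
    by (intro measurable_completion) simp
  have v\<gamma>: "integrable lebesgue (\<lambda>y. (v y)\<^sup>2 / weight \<gamma> y)"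
    "(LINT y|lebesgue. (v y)\<^sup>2 / weight \<gamma> y) \<le> 2 * C * (V_norm s \<Omega> v)\<^sup>2" if v: "v \<in> V_space s \<Omega>" for v
  proof -
    have [measurable]: "v \<in> borel_measurable lebesgue" using v by (simp add: V_space_iff)
    have le: "(v y)\<^sup>2 / weight \<gamma> y \<le> 2 * ((v y)\<^sup>2 / weight s y)" for y
    proof -
      have "weight s y \<le> 2 * weight \<gamma> y" using \<beta> s by (intro weight_le_weight) (auto simp: \<gamma>_def)
      then have "(v y)\<^sup>2 / (2 * weight \<gamma> y) \<le> (v y)\<^sup>2 / weight s y"
        using weight_pos[of s y] weight_pos[of \<gamma> y] by (intro divide_left_mono) auto
      then show ?thesis by simp
    qed
    show i: "integrable lebesgue (\<lambda>y. (v y)\<^sup>2 / weight \<gamma> y)"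
    proof (rule Bochner_Integration.integrable_bound)
      show "integrable lebesgue (\<lambda>y. 2 * ((v y)\<^sup>2 / weight s y))"
        by (rule integrable_mult_right) (rule C(2)[OF v])
    qed (use le in \<open>auto simp: weight_pos less_imp_le\<close>)
    have "(LINT y|lebesgue. (v y)\<^sup>2 / weight \<gamma> y) \<le> (LINT y|lebesgue. 2 * ((v y)\<^sup>2 / weight s y))"
      by (intro integral_mono i le integrable_mult_right C(2)[OF v])
    also have "\<dots> = 2 * (LINT y|lebesgue. (v y)\<^sup>2 / weight s y)"
      by (rule integral_mult_right_zero)
    finally show "(LINT y|lebesgue. (v y)\<^sup>2 / weight \<gamma> y) \<le> 2 * C * (V_norm s \<Omega> v)\<^sup>2"
      using C(3)[OF v] by simp
  qed
  define F where "F v = L2_inner \<Omega> f v + L2_inner (exterior \<Omega>) g v" for v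
  have gv: "integrable (lebesgue_on (exterior \<Omega>)) (\<lambda>x. g x * v x)"
    and gb: "(L2_inner (exterior \<Omega>) g v)\<^sup>2
      \<le> (L2w_dual_norm \<gamma> (exterior \<Omega>) g)\<^sup>2 * (LINT x|lebesgue. (v x)\<^sup>2 / weight \<gamma> x)"
    if v: "v \<in> V_space s \<Omega>" for v
    using L2w_dual_pairing[OF g[folded \<gamma>_def] exterior_measurable _ v\<gamma>(1)[OF v]] v
    by (auto simp: V_space_iff)
  define N where "N = 2 * L2_inner \<Omega> f f + 4 * (L2w_dual_norm \<gamma> (exterior \<Omega>) g)\<^sup>2 * C"
  have N: "0 \<le> N" using C(1) by (simp add: N_def L2_inner_self_nonneg)
  have "\<exists>u\<in>V_space s \<Omega>. \<forall>v\<in>V_space s \<Omega>. energy_form s \<alpha> \<Omega> u v = F v"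
  proof (rule Riesz_representation_semi_inner_product[where M="N * (1 + 1 / \<alpha>)"])
    show "V_space s \<Omega> \<noteq> {}"
    proof -
      have "slope s (\<lambda>_. 0) = (\<lambda>_::'a \<times> 'a. 0)" by (auto simp: slope_def)
      then have "(\<lambda>_. 0) \<in> V_space s \<Omega>" by (simp add: V_space_iff square_integrable_def)
      then show ?thesis by blast
    qed
    show "F (\<lambda>x. a * u x + b * v x) = a * F u + b * F v"
      if "u \<in> V_space s \<Omega>" "v \<in> V_space s \<Omega>" for u v a b
    proof -
      have "integrable (lebesgue_on \<Omega>) (\<lambda>x. f x * u x)" "integrable (lebesgue_on \<Omega>) (\<lambda>x. f x * v x)"
        using that by (auto simp: V_space_iff intro: square_integrable_mult f')
      moreover have "h x * (a * u x + b * v x) = a * (h x * u x) + b * (h x * v x)" for h :: "'a \<Rightarrow> real" and x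
        by (simp add: algebra_simps)
      ultimately show ?thesis
        using gv[OF that(1)] gv[OF that(2)] by (simp add: F_def L2_inner_def algebra_simps)
    qed
    show "(F v)\<^sup>2 \<le> N * (1 + 1 / \<alpha>) * energy_form s \<alpha> \<Omega> v v" if v: "v \<in> V_space s \<Omega>" for v
    proof -
      have "(L2_inner \<Omega> f v)\<^sup>2 \<le> L2_inner \<Omega> f f * L2_inner \<Omega> v v"
        using square_integrable_Cauchy_Schwarz[OF f', of v] v
        by (auto simp: V_space_iff L2_inner_def power2_eq_square)
      also have "\<dots> \<le> L2_inner \<Omega> f f * (V_norm s \<Omega> v)\<^sup>2"
        using s by (intro mult_left_mono) (auto simp: V_norm_power2 L2_inner_self_nonneg X_inner_self_nonneg)
      finally have 1: "(L2_inner \<Omega> f v)\<^sup>2 \<le> L2_inner \<Omega> f f * (V_norm s \<Omega> v)\<^sup>2" .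
      note gb[OF v]
      also have "(L2w_dual_norm \<gamma> (exterior \<Omega>) g)\<^sup>2 * (LINT x|lebesgue. (v x)\<^sup>2 / weight \<gamma> x)
          \<le> (L2w_dual_norm \<gamma> (exterior \<Omega>) g)\<^sup>2 * (2 * C * (V_norm s \<Omega> v)\<^sup>2)"
        using v\<gamma>(2)[OF v] by (intro mult_left_mono) auto
      finally have 2: "(L2_inner (exterior \<Omega>) g v)\<^sup>2
          \<le> (L2w_dual_norm \<gamma> (exterior \<Omega>) g)\<^sup>2 * (2 * C * (V_norm s \<Omega> v)\<^sup>2)" .
      have "(F v)\<^sup>2 \<le> 2 * (L2_inner \<Omega> f v)\<^sup>2 + 2 * (L2_inner (exterior \<Omega>) g v)\<^sup>2"
        unfolding F_def using sum_squares_bound[of "L2_inner \<Omega> f v" "L2_inner (exterior \<Omega>) g v"]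
        by (simp add: power2_sum)
      also have "\<dots> \<le> N * (V_norm s \<Omega> v)\<^sup>2"
        using 1 2 by (simp add: N_def algebra_simps)
      also have "\<dots> \<le> N * ((1 + 1 / \<alpha>) * energy_form s \<alpha> \<Omega> v v)"
        using N by (intro mult_left_mono V_norm_power2_le_energy_form s \<alpha>)
      finally show ?thesis by (simp add: mult.assoc)
    qed
    show "0 \<le> N * (1 + 1 / \<alpha>)" using N \<alpha> by simp
    show "energy_form s \<alpha> \<Omega> u v = energy_form s \<alpha> \<Omega> v u" for u v
      by (rule energy_form_sym)
    show "0 \<le> energy_form s \<alpha> \<Omega> u u" for u
      by (rule energy_form_nonneg[OF s \<alpha>])
  qed (fact V_space_lincomb energy_form_lincomb V_space_complete[OF \<Omega> s \<alpha>])+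
  then show ?thesis by (auto simp: solution_def energy_form_def F_def)
qed

text \<open>
  A difference of solutions has zero energy, and the weighted bound turns this into vanishing almost
  everywhere, on \<open>\<Omega>\<close> and outside at once.
\<close>

lemma solution_unique:
  fixes \<Omega> :: "'a::euclidean_space set"
  assumes \<Omega>: "open \<Omega>" "bounded \<Omega>" "\<Omega> \<noteq> {}" and s: "0 < s" "s < 1" and \<alpha>: "0 < \<alpha>"
    and u: "solution s \<alpha> \<Omega> f g u" and w: "solution s \<alpha> \<Omega> f g w"
  shows "AE x in lebesgue. u x = w x"
proof -
  have uw: "u \<in> V_space s \<Omega>" "w \<in> V_space s \<Omega>" using u w by (auto simp: solution_def)
  define z where "z = (\<lambda>x. u x - w x)"
  have z: "z \<in> V_space s \<Omega>" unfolding z_def by (intro V_space_diff uw)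
  obtain C where C: "integrable lebesgue (\<lambda>y. (z y)\<^sup>2 / weight s y)"
    "(LINT y|lebesgue. (z y)\<^sup>2 / weight s y) \<le> C * (V_norm s \<Omega> z)\<^sup>2" "0 < C"
    using L2w_bound_by_V_norm[OF \<Omega> s] z by blast
  have "energy_form s \<alpha> \<Omega> z z = energy_form s \<alpha> \<Omega> u z - energy_form s \<alpha> \<Omega> w z"
    using energy_form_lincomb[OF uw z, of \<alpha> 1 "-1"] by (simp add: z_def)
  also have "\<dots> = 0" using u w z by (simp add: solution_def energy_form_def)
  finally have "(V_norm s \<Omega> z)\<^sup>2 \<le> 0"
    using V_norm_power2_le_energy_form[OF s \<alpha>, of \<Omega> z] by simp
  then have "(LINT y|lebesgue. (z y)\<^sup>2 / weight s y) \<le> 0"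
    using C by simp
  moreover have "0 \<le> (LINT y|lebesgue. (z y)\<^sup>2 / weight s y)"
    by (simp add: weight_pos less_imp_le)
  ultimately have "(LINT y|lebesgue. (z y)\<^sup>2 / weight s y) = 0"
    by simp
  then have "AE y in lebesgue. (z y)\<^sup>2 / weight s y = 0"
    using C(1) by (subst (asm) integral_nonneg_eq_0_iff_AE) (auto simp: weight_pos less_imp_le)
  then show ?thesis
  proof eventually_elim
    case (elim y)
    then show ?case using weight_pos[of s y] by (simp add: z_def)
  qed
qed

section \<open>The far field\<close>

lemma norm_diff_bounds_far:
  fixes x y :: "'a::real_normed_vector"
  assumes "norm x \<le> R" "2 * R < norm y"
  shows "norm y / 2 \<le> norm (x - y)" "norm (x - y) \<le> 2 * norm y"
  using assms norm_triangle_ineq2[of y x] norm_triangle_ineq4[of x y] norm_minus_commute[of x y]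
    norm_ge_zero[of x] by auto

text \<open>
  Two points both outside \<open>closure \<Omega>\<close> do not interact, so only pairs with one point in the bounded set
  \<open>closure \<Omega>\<close> and the other in the support of \<open>v\<close> contribute. They are at distance at least \<open>1\<close>, and the
  double integral is at most twice the measure of \<open>closure \<Omega>\<close> times \<open>\<integral> v\<^sup>2\<close>.
\<close>

lemma far_supported_in_V_space:
  fixes \<Omega> :: "'a::euclidean_space set"
  assumes R: "1 \<le> R" "closure \<Omega> \<subseteq> cball 0 R" and s: "0 < s"
    and v: "v \<in> borel_measurable lebesgue" "integrable lebesgue (\<lambda>y. (v y)\<^sup>2)"
    and supp: "\<And>y. norm y \<le> 2 * R \<Longrightarrow> v y = 0"
  shows "v \<in> V_space s \<Omega>"
proof -
  define K where "K = closure \<Omega>"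
  define p where "p = real DIM('a) + 2 * s"
  have p: "0 < p" using s by (simp add: p_def add_pos_pos)
  have K: "norm x \<le> R" if "x \<in> K" for x using R(2) that by (auto simp: K_def)
  have v0: "v x = 0" if "x \<in> K" for x using K[OF that] R(1) by (intro supp) auto
  have "bounded K" using R(2) bounded_cball bounded_subset by (auto simp: K_def)
  then have "compact K" by (simp add: K_def compact_eq_bounded_closed)
  then have iK: "integrable lebesgue (indicat_real K)"
    using lmeasurable_compact[of K] by (auto simp: fmeasurable_def intro!: integrable_real_indicator)
  have \<Omega>0: "v x = 0" if "x \<in> \<Omega>" for x
    using that closure_subset[of \<Omega>] by (intro v0) (auto simp: K_def)
  have t1: "integrable lebesgue (\<lambda>z. indicat_real K (fst z) * (v (snd z))\<^sup>2)"
    and t2: "integrable lebesgue (\<lambda>z. (v (fst z))\<^sup>2 * indicat_real K (snd z))"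
    by (intro integrable_lebesgue_tensor iK v(2); simp)+
  have le: "(slope s v (x, y))\<^sup>2 \<le> (v y)\<^sup>2" "(slope s v (y, x))\<^sup>2 \<le> (v y)\<^sup>2" if x: "x \<in> K" for x y
  proof -
    have *: "(v y)\<^sup>2 / norm (x - y) powr p \<le> (v y)\<^sup>2"
    proof (cases "norm y \<le> 2 * R")
      case False
      then have "1 \<le> norm (x - y)"
        using norm_diff_bounds_far[OF K[OF x], of y] R(1) by auto
      then have "1 \<le> norm (x - y) powr p" using p by (simp add: ge_one_powr_ge_zero)
      then show ?thesis by (simp add: divide_le_eq mult_le_cancel_left1)
    qed (simp add: supp)
    show "(slope s v (x, y))\<^sup>2 \<le> (v y)\<^sup>2" "(slope s v (y, x))\<^sup>2 \<le> (v y)\<^sup>2"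
      using * v0[OF x]
      by (simp_all add: slope_def power_divide p_def[symmetric] power2_eq_square powr_add[symmetric] norm_minus_commute)
  qed
  have "integrable lebesgue (\<lambda>z. indicator (X_domain \<Omega>) z *\<^sub>R (slope s v z)\<^sup>2)"
  proof (rule Bochner_Integration.integrable_bound)
    show "integrable lebesgue (\<lambda>z. indicat_real K (fst z) * (v (snd z))\<^sup>2 + (v (fst z))\<^sup>2 * indicat_real K (snd z))"
      by (intro Bochner_Integration.integrable_add t1 t2)
    have [measurable]: "slope s v \<in> borel_measurable lebesgue" by (rule slope_measurable[OF v(1)])
    show "(\<lambda>z. indicator (X_domain \<Omega>) z *\<^sub>R (slope s v z)\<^sup>2) \<in> borel_measurable lebesgue" by measurable
    have "indicator (X_domain \<Omega>) z * (slope s v z)\<^sup>2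
        \<le> indicat_real K (fst z) * (v (snd z))\<^sup>2 + (v (fst z))\<^sup>2 * indicat_real K (snd z)" for z
    proof -
      obtain x y where z: "z = (x, y)" by (cases z)
      have "z \<in> X_domain \<Omega> \<longleftrightarrow> x \<in> K \<or> y \<in> K" by (auto simp: z X_domain_def exterior_def K_def)
      then show ?thesis using le[of x y] le[of y x] v0 by (auto simp: z indicator_def)
    qed
    then show "AE z in lebesgue. norm (indicator (X_domain \<Omega>) z *\<^sub>R (slope s v z)\<^sup>2)
        \<le> norm (indicat_real K (fst z) * (v (snd z))\<^sup>2 + (v (fst z))\<^sup>2 * indicat_real K (snd z))"
      by simp
  qed
  moreover have "integrable (lebesgue_on \<Omega>) (\<lambda>x. (v x)\<^sup>2)"
    by (subst Bochner_Integration.integrable_cong[where g="\<lambda>_. 0" and N="lebesgue_on \<Omega>"]) (auto simp: \<Omega>0)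
  ultimately show ?thesis
    using v(1) by (auto simp: V_space_iff square_integrable_def integrable_restrict_space
        intro: measurable_restrict_space1 slope_measurable)
qed

text \<open>
  For \<open>x \<in> closure \<Omega>\<close> and \<open>y \<in> A\<close> the integrand of \<open>\<langle>u, v\<rangle>\<^sub>X\<close> is \<open>q \<phi>(y) (u(y)\<^sup>2 - u(x) u(y))\<close>, where \<open>q\<close> is the
  quotient of \<open>|y|\<close> and \<open>|x - y|\<close> to the power \<open>p\<close>, which lies between \<open>2^(-p)\<close> and \<open>2^p\<close>. With
  \<open>u(x) u(y) \<le> u(x)\<^sup>2 / 2 + u(y)\<^sup>2 / 2\<close> this is bounded below by a difference of functions of product form,
  whose integrals factorise. The factor \<open>|y|^p\<close> in \<open>v\<close> is chosen to cancel the decay of the kernel.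
\<close>

lemma X_inner_far_lower_bound:
  fixes \<Omega> :: "'a::euclidean_space set"
  defines "p s \<equiv> real DIM('a) + 2 * s"
  assumes R: "1 \<le> R" "closure \<Omega> \<subseteq> cball 0 R" and s: "0 < s" "s < 1"
    and A: "A \<in> sets lebesgue" "\<And>y. y \<in> A \<Longrightarrow> 2 * R < norm y"
    and \<phi>: "integrable lebesgue \<phi>" "\<And>y. 0 \<le> \<phi> y"
    and u: "u \<in> V_space s \<Omega>" "integrable lebesgue (\<lambda>x. indicator (closure \<Omega>) x * (u x)\<^sup>2)"
    and uA: "integrable lebesgue (\<lambda>y. indicator A y * (\<phi> y * (u y)\<^sup>2))"
    and v: "v \<in> V_space s \<Omega>" "\<And>y. v y = indicator A y * (norm y powr p s * \<phi> y * u y)"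
  shows "frac_const DIM('a) s *
      (2 powr (- p s) / 2 * measure lebesgue (closure \<Omega>) * (LINT y|lebesgue. indicator A y * (\<phi> y * (u y)\<^sup>2))
       - 2 powr p s / 2 * (LINT x|lebesgue. indicator (closure \<Omega>) x * (u x)\<^sup>2) * (LINT y|lebesgue. \<phi> y))
    \<le> X_inner s \<Omega> u v"
proof -
  define K where "K = closure \<Omega>"
  define P where "P = p s"
  define c where "c = frac_const DIM('a) s"
  have c: "0 < c" using s by (simp add: c_def frac_const_pos)
  have P: "0 < P" using s by (simp add: P_def p_def add_pos_pos)
  have K: "norm x \<le> R" if "x \<in> K" for x using R(2) that by (auto simp: K_def)
  have AK: "x \<notin> A" if "x \<in> K" for x using K[OF that] A(2)[of x] R(1) by auto
  have "bounded K" using R(2) bounded_cball bounded_subset by (auto simp: K_def)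
  then have "compact K" by (simp add: K_def compact_eq_bounded_closed)
  then have Km: "K \<in> lmeasurable" by (rule lmeasurable_compact)
  then have iK: "integrable lebesgue (indicat_real K)" by (auto simp: fmeasurable_def intro!: integrable_real_indicator)
  define I where "I = (LINT y|lebesgue. indicator A y * (\<phi> y * (u y)\<^sup>2))"
  define U where "U = (LINT x|lebesgue. indicator K x * (u x)\<^sup>2)"
  define \<Phi> where "\<Phi> = (LINT y|lebesgue. \<phi> y)"
  define a where "a = 2 powr (- P) / 2"
  define b where "b = 2 powr P / 2"
  have ab: "0 < a" "0 < b" by (auto simp: a_def b_def)
  \<comment> \<open>lower bounds for the integrand when the first, respectively the second, point lies in \<open>K\<close>\<close>
  define T where "T x y = a * (indicat_real K x * (indicator A y * (\<phi> y * (u y)\<^sup>2)))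
      - b * ((indicat_real K x * (u x)\<^sup>2) * \<phi> y)" for x y
  define T' where "T' x y = a * ((indicator A x * (\<phi> x * (u x)\<^sup>2)) * indicat_real K y)
      - b * (\<phi> x * (indicat_real K y * (u y)\<^sup>2))" for x y
  have T': "T' x y = T y x" for x y by (simp add: T_def T'_def)
  have iu: "integrable lebesgue (\<lambda>x. indicat_real K x * (u x)\<^sup>2)" using u(2) by (simp add: K_def)
  have KI: "integral\<^sup>L lebesgue (indicat_real K) = measure lebesgue K" using Km by simp
  have "integrable lebesgue (\<lambda>z. T (fst z) (snd z))"
    and IT: "(LINT z|lebesgue. T (fst z) (snd z)) = a * (measure lebesgue K * I) - b * (U * \<Phi>)"
    using integrable_lebesgue_tensor[OF iK _ uA] integrable_lebesgue_tensor[OF iu _ \<phi>]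
      integral_lebesgue_tensor[OF iK _ uA] integral_lebesgue_tensor[OF iu _ \<phi>]
    by (simp_all add: T_def \<phi>(2) KI I_def[symmetric] U_def[symmetric] \<Phi>_def[symmetric]
        del: Bochner_Integration.integral_indicator)
  moreover have "integrable lebesgue (\<lambda>z. T' (fst z) (snd z))"
    and IT': "(LINT z|lebesgue. T' (fst z) (snd z)) = a * (measure lebesgue K * I) - b * (U * \<Phi>)"
    using integrable_lebesgue_tensor[OF uA _ iK] integrable_lebesgue_tensor[OF \<phi> iu]
      integral_lebesgue_tensor[OF uA _ iK] integral_lebesgue_tensor[OF \<phi> iu]
    by (simp_all add: T'_def \<phi>(2) KI I_def[symmetric] U_def[symmetric] \<Phi>_def[symmetric]
        mult.commute[of I] mult.commute[of \<Phi>] del: Bochner_Integration.integral_indicator)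
  ultimately have iTT: "integrable lebesgue (\<lambda>z. T (fst z) (snd z) + T' (fst z) (snd z))"
    and ITT: "(LINT z|lebesgue. T (fst z) (snd z) + T' (fst z) (snd z))
      = 2 * (a * (measure lebesgue K * I) - b * (U * \<Phi>))"
    by simp_all
  have pw: "T x y \<le> slope s u (x, y) * slope s v (x, y)" if x: "x \<in> K" for x y
  proof (cases "y \<in> A")
    case True
    define n where "n = norm (x - y) powr P"
    have y: "2 * R < norm y" using A(2)[OF True] .
    have ny: "0 < norm y" using y R(1) by linarith
    note nb = norm_diff_bounds_far[OF K[OF x] y]
    have n0: "0 < n" using nb ny by (auto simp: n_def)
    have n1: "n \<le> 2 powr P * norm y powr P"
      using nb(2) P powr_mono2[of P "norm (x - y)" "2 * norm y"] by (simp add: n_def powr_mult)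
    have n2: "norm y powr P \<le> 2 powr P * n"
      using nb(1) P powr_mono2[of P "norm y" "2 * norm (x - y)"] by (simp add: n_def powr_mult)
    define q where "q = norm y powr P / n"
    have q: "2 powr (- P) \<le> q" "q \<le> 2 powr P"
      using n0 n1 n2 by (auto simp: q_def powr_minus_divide field_simps)
    have "v x = 0" using v(2) AK[OF x] by simp
    then have "slope s u (x, y) * slope s v (x, y) = (u x - u y) * (0 - v y) / n"
      by (simp add: X_integrand_eq_slope[symmetric] X_integrand_def n_def P_def p_def)
    also have "(u x - u y) * (0 - v y) = (u y - u x) * v y"
      by (simp add: algebra_simps)
    finally have "slope s u (x, y) * slope s v (x, y) = (u y - u x) * v y / n" .
    also have "(u y - u x) * v y / n = \<phi> y * (q * ((u y)\<^sup>2 - u x * u y))"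
      using True by (simp add: v(2) q_def P_def power2_eq_square algebra_simps diff_divide_distrib)
    finally have eq: "slope s u (x, y) * slope s v (x, y) = \<phi> y * (q * ((u y)\<^sup>2 - u x * u y))" .
    have "q * ((u y)\<^sup>2 - u x * u y) \<ge> q * ((u y)\<^sup>2 / 2 - (u x)\<^sup>2 / 2)"
    proof (rule mult_left_mono)
      show "(u y)\<^sup>2 / 2 - (u x)\<^sup>2 / 2 \<le> (u y)\<^sup>2 - u x * u y"
        using sum_squares_bound[of "u x" "u y"] by simp
      show "0 \<le> q" using q(1) order_trans[OF _ q(1)] by simp
    qed
    moreover have "q * (u y)\<^sup>2 \<ge> 2 powr (- P) * (u y)\<^sup>2" "q * (u x)\<^sup>2 \<le> 2 powr P * (u x)\<^sup>2"
      using q by (auto intro: mult_right_mono)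
    ultimately have "a * (u y)\<^sup>2 - b * (u x)\<^sup>2 \<le> q * ((u y)\<^sup>2 - u x * u y)"
      by (simp add: a_def b_def right_diff_distrib)
    then have "\<phi> y * (a * (u y)\<^sup>2 - b * (u x)\<^sup>2) \<le> slope s u (x, y) * slope s v (x, y)"
      unfolding eq by (intro mult_left_mono \<phi>)
    then show ?thesis using x True by (simp add: T_def algebra_simps)
  next
    case False
    then have "v x = 0" "v y = 0" using v(2) AK[OF x] by auto
    then show ?thesis using False ab \<phi>(2) by (simp add: T_def slope_def)
  qed
  have slope_swap: "slope s w (y, x) = - slope s w (x, y)" for w :: "'a \<Rightarrow> real" and x y
    by (simp add: slope_def norm_minus_commute[of x y] minus_divide_left)
  have Tn: "T x y \<le> 0" if "y \<notin> A" for x y using that ab \<phi>(2) by (simp add: T_def)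
  have T0: "T x y = 0" if "x \<notin> K" for x y using that by (simp add: T_def)
  have i: "integrable (lebesgue_on (X_domain \<Omega>)) (\<lambda>z. slope s u z * slope s v z)"
    using u(1) v(1) by (intro square_integrable_mult) (auto simp: V_space_iff)
  have "2 * (a * (measure lebesgue K * I) - b * (U * \<Phi>)) = (LINT z|lebesgue. T (fst z) (snd z) + T' (fst z) (snd z))"
    by (simp only: ITT)
  also have "\<dots> \<le> (LINT z|lebesgue. indicator (X_domain \<Omega>) z *\<^sub>R (slope s u z * slope s v z))"
  proof (rule integral_mono[OF iTT])
    show "integrable lebesgue (\<lambda>z. indicator (X_domain \<Omega>) z *\<^sub>R (slope s u z * slope s v z))"
      using i by (simp add: integrable_restrict_space)
    fix z :: "'a \<times> 'a"
    obtain x y where z: "z = (x, y)" by (cases z)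
    have X: "z \<in> X_domain \<Omega> \<longleftrightarrow> x \<in> K \<or> y \<in> K" by (auto simp: z X_domain_def exterior_def K_def)
    show "T (fst z) (snd z) + T' (fst z) (snd z) \<le> indicator (X_domain \<Omega>) z *\<^sub>R (slope s u z * slope s v z)"
    proof (cases "x \<in> K")
      case True
      then show ?thesis using X pw[OF True, of y] Tn[OF AK[OF True], of y] by (simp add: z T')
    next
      case xK: False
      show ?thesis
      proof (cases "y \<in> K")
        case True
        then show ?thesis using X pw[OF True, of x] xK
          by (simp add: z T' T0 slope_swap[of _ x y])
      qed (use X xK in \<open>simp add: z T' T0\<close>)
    qed
  qed
  also have "\<dots> = 2 / c * X_inner s \<Omega> u v"
    using c by (simp add: X_inner_eq_slope integral_restrict_space c_def[symmetric])
  finally have "c * (a * (measure lebesgue K * I) - b * (U * \<Phi>)) \<le> X_inner s \<Omega> u v"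
    using c by (simp add: field_simps)
  then show ?thesis
    by (simp add: c_def a_def b_def K_def I_def U_def \<Phi>_def P_def mult.assoc)
qed

text \<open>
  The equation tested with \<open>v = \<theta> u\<close> on \<open>A\<close>, where \<open>\<theta> = |y|^(d + 2s) / weight (s - \<beta>)\<close>. As \<open>v\<close> vanishes on
  \<open>\<Omega>\<close>, both \<open>f\<close> and \<open>\<alpha>\<close> drop out. The term \<open>(g, v)\<close> is split by Young's inequality with the parameter \<open>\<kappa>\<close>
  that lets the lower bound for \<open>\<langle>u, v\<rangle>\<^sub>X\<close> absorb half of the result; what remains of \<open>g\<close> has the weight
  \<open>\<theta>\<^sup>2 weight (s - \<beta>) \<le> |y|^(2 (d + 2s) - (d + 2 (s - \<beta>))) \<le> weight (s + \<beta>)\<close>. Absorbing requires the left side to be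
  finite, which is why \<open>A\<close> is bounded; the estimate itself is uniform in \<open>A\<close>.
\<close>

lemma solution_tail_estimate:
  fixes \<Omega> :: "'a::euclidean_space set"
  defines "p s \<equiv> real DIM('a) + 2 * s"
  assumes R: "1 \<le> R" "closure \<Omega> \<subseteq> cball 0 R" and s: "0 < s" "s < 1" and \<beta>: "0 < \<beta>" "\<beta> < s"
    and g: "g \<in> L2w_dual_space (s + \<beta>) (exterior \<Omega>)"
    and sol: "solution s \<alpha> \<Omega> f g u"
    and us: "integrable lebesgue (\<lambda>y. (u y)\<^sup>2 / weight s y)"
    and uK: "integrable lebesgue (\<lambda>x. indicator (closure \<Omega>) x * (u x)\<^sup>2)"
    and A: "A \<in> sets lebesgue" "\<And>y. y \<in> A \<Longrightarrow> 2 * R < norm y" "bounded A"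
    and \<kappa>: "\<kappa> = frac_const DIM('a) s * (2 powr (- p s) / 2 * measure lebesgue (closure \<Omega>))" "0 < \<kappa>"
  shows "integrable lebesgue (\<lambda>y. indicator A y * ((u y)\<^sup>2 / weight (s - \<beta>) y))"
    and "(LINT y|lebesgue. indicator A y * ((u y)\<^sup>2 / weight (s - \<beta>) y))
      \<le> frac_const DIM('a) s * 2 powr p s * (LINT y::'a|lebesgue. 1 / weight (s - \<beta>) y) / \<kappa>
            * (LINT x|lebesgue. indicator (closure \<Omega>) x * (u x)\<^sup>2)
        + (L2w_dual_norm (s + \<beta>) (exterior \<Omega>) g)\<^sup>2 / \<kappa>\<^sup>2"
proof -
  define P where "P = p s"
  define c where "c = frac_const DIM('a) s"
  define \<phi> where "\<phi> y = 1 / weight (s - \<beta>) y" for y :: 'a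
  define \<theta> where "\<theta> y = norm y powr P * \<phi> y" for y
  define v where "v y = indicator A y * (\<theta> y * u y)" for y
  define I where "I = (LINT y|lebesgue. indicator A y * (\<phi> y * (u y)\<^sup>2))"
  define U where "U = (LINT x|lebesgue. indicator (closure \<Omega>) x * (u x)\<^sup>2)"
  define \<Phi> where "\<Phi> = (LINT y|lebesgue. \<phi> y)"
  define G where "G = L2w_dual_norm (s + \<beta>) (exterior \<Omega>) g"
  have P: "0 < P" using s by (simp add: P_def p_def add_pos_pos)
  have uV: "u \<in> V_space s \<Omega>" using sol by (simp add: solution_def)
  have [measurable]: "u \<in> borel_measurable lebesgue" using uV by (simp add: V_space_iff)
  have [measurable]: "(weight \<delta> :: 'a \<Rightarrow> real) \<in> borel_measurable lebesgue" for \<delta>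
    by (intro measurable_completion) simp
  have [measurable]: "(\<lambda>y::'a. norm y powr r) \<in> borel_measurable lebesgue" for r
    by (intro measurable_completion) simp
  have \<phi>0: "0 < \<phi> y" and \<phi>1: "\<phi> y \<le> 1" for y
    using weight_ge_1[of "s - \<beta>" y] weight_pos[of "s - \<beta>" y] by (auto simp: \<phi>_def)
  have i\<phi>: "integrable lebesgue \<phi>"
    unfolding \<phi>_def[abs_def] using \<beta> by (intro integrable_inverse_weight) simp
  obtain N where N: "1 \<le> N" "\<And>y. y \<in> A \<Longrightarrow> norm y \<le> N"
    using A(3) by (metis bounded_pos max.cobounded1 max.coboundedI2)
  have wN: "weight s y \<le> 1 + N powr P" "norm y powr P \<le> N powr P" if "y \<in> A" for y
    using powr_mono2[OF less_imp_le[OF P] _ N(2)[OF that]] by (auto simp: weight_def P_def p_def)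
  have u2: "(u y)\<^sup>2 \<le> (1 + N powr P) * ((u y)\<^sup>2 / weight s y)" if "y \<in> A" for y
  proof -
    have "(u y)\<^sup>2 = weight s y * ((u y)\<^sup>2 / weight s y)"
      using weight_pos[of s y] by simp
    also have "\<dots> \<le> (1 + N powr P) * ((u y)\<^sup>2 / weight s y)"
      using wN(1)[OF that] weight_pos[of s y] by (intro mult_right_mono) auto
    finally show ?thesis .
  qed
  have iA: "integrable lebesgue (\<lambda>y. indicator A y * (\<phi> y * (u y)\<^sup>2))"
  proof (rule Bochner_Integration.integrable_bound)
    show "integrable lebesgue (\<lambda>y. (1 + N powr P) * ((u y)\<^sup>2 / weight s y))"
      by (intro integrable_mult_right us)
    have "(\<lambda>y. indicator A y * (\<phi> y * (u y)\<^sup>2)) \<in> borel_measurable lebesgue"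
      using A(1) unfolding \<phi>_def by measurable
    then show "(\<lambda>y. indicator A y * (\<phi> y * (u y)\<^sup>2)) \<in> borel_measurable lebesgue" .
    have le: "indicator A y * (\<phi> y * (u y)\<^sup>2) \<le> (1 + N powr P) * ((u y)\<^sup>2 / weight s y)" for y
    proof (cases "y \<in> A")
      case True
      have "\<phi> y * (u y)\<^sup>2 \<le> 1 * (u y)\<^sup>2" by (intro mult_right_mono \<phi>1) auto
      with u2[OF True] True show ?thesis by simp
    qed (use weight_pos[of s y] in simp)
    show "AE y in lebesgue. norm (indicator A y * (\<phi> y * (u y)\<^sup>2))
        \<le> norm ((1 + N powr P) * ((u y)\<^sup>2 / weight s y))"
    proof (intro always_eventually allI)
      fix y
      have "0 \<le> indicator A y * (\<phi> y * (u y)\<^sup>2)" using \<phi>0[of y] by simp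
      then show "norm (indicator A y * (\<phi> y * (u y)\<^sup>2)) \<le> norm ((1 + N powr P) * ((u y)\<^sup>2 / weight s y))"
        using le[of y] by (simp only: real_norm_def)
    qed
  qed
  then show "integrable lebesgue (\<lambda>y. indicator A y * ((u y)\<^sup>2 / weight (s - \<beta>) y))"
    by (simp add: \<phi>_def)
  have vm [measurable]: "v \<in> borel_measurable lebesgue"
    using A(1) unfolding v_def \<theta>_def \<phi>_def by measurable
  have v2: "integrable lebesgue (\<lambda>y. (v y)\<^sup>2)"
  proof (rule Bochner_Integration.integrable_bound)
    show "integrable lebesgue (\<lambda>y. (N powr P)\<^sup>2 * ((1 + N powr P) * ((u y)\<^sup>2 / weight s y)))"
      by (intro integrable_mult_right us)
    have le: "(v y)\<^sup>2 \<le> (N powr P)\<^sup>2 * ((1 + N powr P) * ((u y)\<^sup>2 / weight s y))" for y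
    proof (cases "y \<in> A")
      case True
      have "\<theta> y \<le> N powr P * 1"
        unfolding \<theta>_def using wN(2)[OF True] \<phi>1[of y] \<phi>0[of y] by (intro mult_mono) auto
      then have "(\<theta> y)\<^sup>2 \<le> (N powr P)\<^sup>2"
        using \<phi>0[of y] by (intro power_mono) (auto simp: \<theta>_def)
      then have "(\<theta> y)\<^sup>2 * (u y)\<^sup>2 \<le> (N powr P)\<^sup>2 * ((1 + N powr P) * ((u y)\<^sup>2 / weight s y))"
        using u2[OF True] by (intro mult_mono) auto
      then show ?thesis using True by (simp add: v_def power_mult_distrib)
    qed (use weight_pos[of s y] in \<open>simp add: v_def\<close>)
    show "AE y in lebesgue. norm ((v y)\<^sup>2)
        \<le> norm ((N powr P)\<^sup>2 * ((1 + N powr P) * ((u y)\<^sup>2 / weight s y)))"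
    proof (intro always_eventually allI)
      fix y
      show "norm ((v y)\<^sup>2) \<le> norm ((N powr P)\<^sup>2 * ((1 + N powr P) * ((u y)\<^sup>2 / weight s y)))"
        using le[of y] zero_le_power2[of "v y"] unfolding real_norm_def by (smt (verit))
    qed
  qed measurable
  have vV: "v \<in> V_space s \<Omega>"
    by (rule far_supported_in_V_space[OF R s(1) vm v2]) (use A(2) in \<open>auto simp: v_def indicator_def dest: leD\<close>)
  have Asub: "A \<subseteq> exterior \<Omega>"
    using A(2) R by (force simp: exterior_def)
  then have v\<Omega>: "v x = 0" if "x \<in> \<Omega>" for x
  proof -
    have "x \<notin> A" using that closure_subset[of \<Omega>] Asub by (auto simp: exterior_def)
    then show ?thesis by (simp add: v_def)
  qed
  have zero: "L2_inner \<Omega> h v = 0" for h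
    unfolding L2_inner_def
    by (subst Bochner_Integration.integral_cong[where g="\<lambda>_. 0" and N="lebesgue_on \<Omega>"]) (auto simp: v\<Omega>)
  have eq: "X_inner s \<Omega> u v = L2_inner (exterior \<Omega>) g v"
  proof -
    have "X_inner s \<Omega> u v + \<alpha> * L2_inner \<Omega> u v = L2_inner \<Omega> f v + L2_inner (exterior \<Omega>) g v"
      using sol vV unfolding solution_def by blast
    then show ?thesis by (simp add: zero)
  qed
  have "\<kappa> * I - c * 2 powr P / 2 * \<Phi> * U \<le> X_inner s \<Omega> u v"
    using X_inner_far_lower_bound[OF R s A(1,2) i\<phi> less_imp_le[OF \<phi>0] uV uK iA vV]
    by (simp add: v_def \<theta>_def \<kappa>(1) c_def P_def p_def I_def U_def \<Phi>_def right_diff_distrib mult_ac)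
  also have "X_inner s \<Omega> u v \<le> \<kappa> / 2 * I + G\<^sup>2 / (2 * \<kappa>)"
  proof -
    let ?M = "lebesgue_on (exterior \<Omega>)"
    have pt: "g y * v y \<le> \<kappa> / 2 * (indicator A y * (\<phi> y * (u y)\<^sup>2)) + (1 / (2 * \<kappa>)) * (\<bar>g y\<bar>\<^sup>2 * weight (s + \<beta>) y)" for y
    proof (cases "y \<in> A")
      case True
      have y0: "y \<noteq> 0" using A(2)[OF True] R(1) by auto
      \<comment> \<open>Young's inequality for the splitting of \<open>g \<theta> u\<close> into \<open>u \<surd>\<phi>\<close> and \<open>g \<theta> / \<surd>\<phi>\<close>\<close>
      have "0 \<le> (\<kappa> * u y * \<phi> y - g y * \<theta> y)\<^sup>2 / \<phi> y" using \<phi>0[of y] by simp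
      also have "\<dots> = \<kappa>\<^sup>2 * (\<phi> y * (u y)\<^sup>2) - 2 * \<kappa> * (g y * (\<theta> y * u y)) + (g y)\<^sup>2 * ((\<theta> y)\<^sup>2 / \<phi> y)"
        using \<phi>0[of y] by (simp add: power2_eq_square field_simps)
      also have "(g y)\<^sup>2 * ((\<theta> y)\<^sup>2 / \<phi> y) \<le> (g y)\<^sup>2 * weight (s + \<beta>) y"
      proof (rule mult_left_mono)
        have w: "norm y powr (P - 2 * \<beta>) \<le> weight (s - \<beta>) y"
          by (simp add: weight_def P_def p_def algebra_simps)
        have "(\<theta> y)\<^sup>2 / \<phi> y = (norm y powr P)\<^sup>2 / weight (s - \<beta>) y"
          using \<phi>0[of y] by (simp add: \<theta>_def power2_eq_square) (simp add: \<phi>_def)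
        also have "\<dots> \<le> (norm y powr P)\<^sup>2 / norm y powr (P - 2 * \<beta>)"
          using w y0 weight_pos[of "s - \<beta>" y] by (intro divide_left_mono) auto
        also have "\<dots> = norm y powr (P + 2 * \<beta>)"
          using y0 by (simp add: power2_eq_square powr_add[symmetric] powr_diff[symmetric] algebra_simps)
        also have "\<dots> \<le> weight (s + \<beta>) y"
          by (simp add: weight_def P_def p_def algebra_simps)
        finally show "(\<theta> y)\<^sup>2 / \<phi> y \<le> weight (s + \<beta>) y" .
      qed simp
      finally have "2 * \<kappa> * (g y * (\<theta> y * u y)) \<le> \<kappa>\<^sup>2 * (\<phi> y * (u y)\<^sup>2) + (g y)\<^sup>2 * weight (s + \<beta>) y"
        by simp
      then have "g y * (\<theta> y * u y) \<le> (\<kappa>\<^sup>2 * (\<phi> y * (u y)\<^sup>2) + (g y)\<^sup>2 * weight (s + \<beta>) y) / (2 * \<kappa>)"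
        using \<kappa>(2) by (simp add: field_simps)
      also have "\<dots> = \<kappa> / 2 * (\<phi> y * (u y)\<^sup>2) + (1 / (2 * \<kappa>)) * ((g y)\<^sup>2 * weight (s + \<beta>) y)"
        using \<kappa>(2) by (simp add: field_simps power2_eq_square)
      finally show ?thesis using True by (simp add: v_def)
    qed (use \<kappa>(2) weight_pos[of "s + \<beta>" y] in \<open>simp add: v_def\<close>)
    have iG: "integrable ?M (\<lambda>y. \<bar>g y\<bar>\<^sup>2 * weight (s + \<beta>) y)" using g by (simp add: L2w_dual_space_def)
    have IG: "(LINT y|?M. \<bar>g y\<bar>\<^sup>2 * weight (s + \<beta>) y) = G\<^sup>2"
      by (simp add: G_def L2w_dual_norm_def weight_pos less_imp_le)
    have EA: "indicator (exterior \<Omega>) y *\<^sub>R (indicator A y * (\<phi> y * (u y)\<^sup>2)) = indicator A y * (\<phi> y * (u y)\<^sup>2)" for y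
      using Asub by (auto simp: indicator_def)
    have E: "exterior \<Omega> \<inter> space lebesgue \<in> sets lebesgue" by simp
    have iAM: "integrable ?M (\<lambda>y. indicator A y * (\<phi> y * (u y)\<^sup>2))"
      unfolding integrable_restrict_space[OF E] EA by (rule iA)
    have IAM: "(LINT y|?M. indicator A y * (\<phi> y * (u y)\<^sup>2)) = I"
      unfolding integral_restrict_space[OF E] EA I_def ..
    have igv: "integrable ?M (\<lambda>y. g y * v y)"
    proof (rule L2w_dual_pairing(1)[OF g exterior_measurable vm])
      show "integrable lebesgue (\<lambda>y. (v y)\<^sup>2 / weight (s + \<beta>) y)"
      proof (rule Bochner_Integration.integrable_bound[OF v2])
        show "AE y in lebesgue. norm ((v y)\<^sup>2 / weight (s + \<beta>) y) \<le> norm ((v y)\<^sup>2)"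
        proof (intro always_eventually allI)
          fix y
          have "(v y)\<^sup>2 / weight (s + \<beta>) y \<le> (v y)\<^sup>2 / 1"
            using weight_ge_1[of "s + \<beta>" y] by (intro divide_left_mono) auto
          then show "norm ((v y)\<^sup>2 / weight (s + \<beta>) y) \<le> norm ((v y)\<^sup>2)"
            using weight_pos[of "s + \<beta>" y] by simp
        qed
      qed measurable
    qed
    have "X_inner s \<Omega> u v = (LINT y|?M. g y * v y)" by (simp add: eq L2_inner_def)
    also have "\<dots> \<le> (LINT y|?M. \<kappa> / 2 * (indicator A y * (\<phi> y * (u y)\<^sup>2)) + (1 / (2 * \<kappa>)) * (\<bar>g y\<bar>\<^sup>2 * weight (s + \<beta>) y))"
      by (intro integral_mono igv pt Bochner_Integration.integrable_add integrable_mult_right iAM iG)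
    also have "\<dots> = \<kappa> / 2 * I + (1 / (2 * \<kappa>)) * G\<^sup>2"
      by (subst Bochner_Integration.integral_add)
         (intro integrable_mult_right iAM iG, intro integrable_mult_right iAM iG,
          simp only: integral_mult_right_zero IAM IG)
    finally show ?thesis by simp
  qed
  finally have "\<kappa> * I \<le> c * 2 powr P * \<Phi> * U + G\<^sup>2 / \<kappa>"
    by (simp add: field_simps)
  then have "I \<le> (c * 2 powr P * \<Phi> * U + G\<^sup>2 / \<kappa>) / \<kappa>"
    using \<kappa>(2) by (simp add: pos_le_divide_eq mult.commute)
  also have "\<dots> = c * 2 powr P * \<Phi> / \<kappa> * U + G\<^sup>2 / \<kappa>\<^sup>2"
    using \<kappa>(2) by (simp add: field_simps power2_eq_square)
  finally show "(LINT y|lebesgue. indicator A y * ((u y)\<^sup>2 / weight (s - \<beta>) y))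
      \<le> frac_const DIM('a) s * 2 powr p s * (LINT y::'a|lebesgue. 1 / weight (s - \<beta>) y) / \<kappa>
            * (LINT x|lebesgue. indicator (closure \<Omega>) x * (u x)\<^sup>2)
        + (L2w_dual_norm (s + \<beta>) (exterior \<Omega>) g)\<^sup>2 / \<kappa>\<^sup>2"
    by (simp add: I_def U_def \<Phi>_def G_def c_def P_def \<phi>_def)
qed

text \<open>
  Inside a large ball all weights are comparable and the energy norm controls \<open>u\<close>. Outside, the tail
  estimate on the shells \<open>2 R < |y| < n\<close> is uniform in \<open>n\<close> and passes to the limit by Fatou.
\<close>

lemma solution_L2w_estimate:
  fixes \<Omega> :: "'a::euclidean_space set"
  assumes \<Omega>: "open \<Omega>" "bounded \<Omega>" "\<Omega> \<noteq> {}" and s: "0 < s" "s < 1" and \<beta>: "0 < \<beta>" "\<beta> < s"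
  shows "\<exists>M>0. \<forall>f. \<forall>g \<in> L2w_dual_space (s + \<beta>) (exterior \<Omega>). \<forall>u. solution s \<alpha> \<Omega> f g u \<longrightarrow>
    integrable lebesgue (\<lambda>y. (u y)\<^sup>2 / weight (s - \<beta>) y) \<and>
    (LINT y|lebesgue. (u y)\<^sup>2 / weight (s - \<beta>) y)
      \<le> M * ((L2w_dual_norm (s + \<beta>) (exterior \<Omega>) g)\<^sup>2 + (V_norm s \<Omega> u)\<^sup>2)"
proof -
  define P where "P = real DIM('a) + 2 * s"
  have P: "0 < P" using s by (simp add: P_def add_pos_pos)
  define c where "c = frac_const DIM('a) s"
  have c: "0 < c" using s by (simp add: c_def frac_const_pos)
  obtain R where R: "1 \<le> R" "closure \<Omega> \<subseteq> cball 0 R"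
  proof -
    obtain b where b: "0 < b" "\<And>x. x \<in> closure \<Omega> \<Longrightarrow> norm x \<le> b"
      using bounded_closure[OF \<Omega>(2)] by (auto simp: bounded_pos)
    show ?thesis by (rule that[of "max 1 b"]) (use b in \<open>auto simp: max_def\<close>, force)
  qed
  obtain C where C: "0 < C" "\<And>v. v \<in> V_space s \<Omega> \<Longrightarrow> integrable lebesgue (\<lambda>y. (v y)\<^sup>2 / weight s y)"
    "\<And>v. v \<in> V_space s \<Omega> \<Longrightarrow> (LINT y|lebesgue. (v y)\<^sup>2 / weight s y) \<le> C * (V_norm s \<Omega> v)\<^sup>2"
    using L2w_bound_by_V_norm[OF \<Omega> s] by blast
  have clm: "closure \<Omega> \<in> lmeasurable"
    using \<Omega>(2) by (simp add: lmeasurable_compact compact_closure)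
  have mK: "0 < measure lebesgue (closure \<Omega>)"
  proof -
    have "\<not> negligible (closure \<Omega>)"
      using open_not_negligible[OF \<Omega>(1,3)] negligible_subset closure_subset by blast
    then show ?thesis
      using clm negligible_iff_measure[of "closure \<Omega>"] by (auto simp: measure_nonneg less_le)
  qed
  define \<kappa> where "\<kappa> = c * (2 powr (- P) / 2 * measure lebesgue (closure \<Omega>))"
  have \<kappa>: "0 < \<kappa>" using c mK by (simp add: \<kappa>_def)
  define \<Phi> where "\<Phi> = (LINT y::'a|lebesgue. 1 / weight (s - \<beta>) y)"
  have \<Phi>: "0 \<le> \<Phi>" by (simp add: \<Phi>_def weight_pos less_imp_le)
  define b1 where "b1 = c * 2 powr P * \<Phi> / \<kappa>"
  have b1: "0 \<le> b1" using c \<Phi> \<kappa> by (simp add: b1_def)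
  \<comment> \<open>the maximum of \<open>weight s\<close> on the ball of radius \<open>2 R\<close>, which contains \<open>closure \<Omega>\<close>\<close>
  define r where "r = 1 + (2 * R) powr P"
  have r: "0 < r" by (simp add: r_def add_pos_nonneg)
  define M where "M = r * C + b1 * (r * C) + 1 / \<kappa>\<^sup>2"
  have "0 < r * C" using r C(1) by simp
  then have M: "0 < M" "r * C + b1 * (r * C) \<le> M" "1 / \<kappa>\<^sup>2 \<le> M"
    using b1 \<kappa> by (auto simp: M_def intro!: add_pos_nonneg add_nonneg_nonneg)
  have near: "(u y)\<^sup>2 \<le> r * ((u y)\<^sup>2 / weight s y)" if "norm y \<le> 2 * R" for u :: "'a \<Rightarrow> real" and y
  proof -
    have "weight s y \<le> r"
      using powr_mono2[OF less_imp_le[OF P] norm_ge_zero that] by (simp add: weight_def r_def P_def)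
    then have "weight s y * ((u y)\<^sup>2 / weight s y) \<le> r * ((u y)\<^sup>2 / weight s y)"
      using weight_pos[of s y] by (intro mult_right_mono) auto
    then show ?thesis using weight_pos[of s y] by simp
  qed
  have "integrable lebesgue (\<lambda>y. (u y)\<^sup>2 / weight (s - \<beta>) y) \<and>
    (LINT y|lebesgue. (u y)\<^sup>2 / weight (s - \<beta>) y)
      \<le> M * ((L2w_dual_norm (s + \<beta>) (exterior \<Omega>) g)\<^sup>2 + (V_norm s \<Omega> u)\<^sup>2)"
    if g: "g \<in> L2w_dual_space (s + \<beta>) (exterior \<Omega>)" and sol: "solution s \<alpha> \<Omega> f g u" for f g u
  proof -
    define G where "G = L2w_dual_norm (s + \<beta>) (exterior \<Omega>) g"
    define V where "V = V_norm s \<Omega> u"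
    have uV: "u \<in> V_space s \<Omega>" using sol by (simp add: solution_def)
    note us = C(2)[OF uV]
    have us2: "(LINT y|lebesgue. r * ((u y)\<^sup>2 / weight s y)) \<le> r * C * V\<^sup>2"
      using C(3)[OF uV] r by (simp only: integral_mult_right_zero V_def mult.assoc mult_left_mono less_imp_le)
    have rus: "integrable lebesgue (\<lambda>y. r * ((u y)\<^sup>2 / weight s y))" by (intro integrable_mult_right us)
    have [measurable]: "u \<in> borel_measurable lebesgue" using uV by (simp add: V_space_iff)
    have [measurable]: "(weight \<delta> :: 'a \<Rightarrow> real) \<in> borel_measurable lebesgue" for \<delta>
      by (intro measurable_completion) simp
    have rn: "0 \<le> r * ((u y)\<^sup>2 / weight s y)" for y using r weight_pos[of s y] by simp
    have Kle: "indicator (closure \<Omega>) y * (u y)\<^sup>2 \<le> r * ((u y)\<^sup>2 / weight s y)" for y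
      using near[of y u] R rn[of y] by (force simp: indicator_def)
    have uK: "integrable lebesgue (\<lambda>x. indicator (closure \<Omega>) x * (u x)\<^sup>2)"
    proof (rule Bochner_Integration.integrable_bound[OF rus])
      have "closure \<Omega> \<in> sets lebesgue" using clm by auto
      then show "(\<lambda>x. indicator (closure \<Omega>) x * (u x)\<^sup>2) \<in> borel_measurable lebesgue" by measurable
      show "AE y in lebesgue. norm (indicator (closure \<Omega>) y * (u y)\<^sup>2) \<le> norm (r * ((u y)\<^sup>2 / weight s y))"
        using Kle rn by (intro always_eventually allI) (metis abs_of_nonneg indicator_pos_le mult_nonneg_nonneg real_norm_def zero_le_power2)
    qed
    define U where "U = (LINT x|lebesgue. indicator (closure \<Omega>) x * (u x)\<^sup>2)"
    have "U \<le> (LINT y|lebesgue. r * ((u y)\<^sup>2 / weight s y))"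
      unfolding U_def by (intro integral_mono uK rus Kle)
    with us2 have U: "U \<le> r * C * V\<^sup>2" by linarith
    define B where "B = b1 * U + G\<^sup>2 / \<kappa>\<^sup>2"
    define A where "A n = {y::'a. 2 * R < norm y \<and> norm y < real n}" for n
    have Aopen: "open (A n)" for n
      unfolding A_def by (intro open_Collect_conj open_Collect_less continuous_intros)
    have Am [measurable]: "A n \<in> sets lebesgue" for n
      using Aopen by (intro sets_completionI_sets) simp
    have Ab: "bounded (A n)" for n
      by (rule bounded_subset[OF bounded_ball[of 0 "real n"]]) (auto simp: A_def)
    \<comment> \<open>square roots of the tail integrands, so that Fatou for \<open>L\<^sup>2\<close> functions applies\<close>
    define h where "h n y = indicator (A n) y * (u y / sqrt (weight (s - \<beta>) y))" for n y
    define l where "l y = indicator (- cball 0 (2 * R)) y * (u y / sqrt (weight (s - \<beta>) y))" for y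
    have h2: "(h n y)\<^sup>2 = indicator (A n) y * ((u y)\<^sup>2 / weight (s - \<beta>) y)" for n y
      by (simp add: h_def power_mult_distrib power_divide indicator_def weight_pos less_imp_le)
    note tail = solution_tail_estimate[OF R s \<beta> g sol us uK Am _ Ab, of _ \<kappa>, folded P_def c_def \<Phi>_def U_def G_def b1_def,
        OF _ \<kappa>_def \<kappa>]
    have ih: "integrable lebesgue (\<lambda>y. (h n y)\<^sup>2)" and Ih: "(LINT y|lebesgue. (h n y)\<^sup>2) \<le> B" for n
    proof -
      have far: "2 * R < norm y" if "y \<in> A n" for y using that by (simp add: A_def)
      show "integrable lebesgue (\<lambda>y. (h n y)\<^sup>2)" unfolding h2 by (rule tail(1)[OF far])
      show "(LINT y|lebesgue. (h n y)\<^sup>2) \<le> B"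
        using tail(2)[OF far] unfolding h2 B_def b1_def .
    qed
    have hs: "h n \<in> square_integrable lebesgue" for n
    proof -
      have "h n \<in> borel_measurable lebesgue" unfolding h_def by measurable
      with ih show ?thesis by (simp add: square_integrable_def)
    qed
    have [measurable]: "- cball (0::'a) (2 * R) \<in> sets lebesgue"
      by (intro sets_completionI_sets) (simp add: borel_open open_Compl)
    have lm: "l \<in> borel_measurable lebesgue" unfolding l_def by measurable
    have lim: "AE y in lebesgue. (\<lambda>n. h n y) \<longlonglongrightarrow> l y"
    proof (intro always_eventually allI)
      fix y :: 'a
      obtain n0 where n0: "norm y < real n0" using reals_Archimedean2 by blast
      have "h n y = l y" if "n0 \<le> n" for n
        using that n0 by (auto simp: h_def l_def A_def indicator_def)
      then have "\<forall>\<^sub>F n in sequentially. h n y = l y"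
        by (auto simp: eventually_sequentially)
      then show "(\<lambda>n. h n y) \<longlonglongrightarrow> l y" by (rule tendsto_eventually)
    qed
    have l: "integrable lebesgue (\<lambda>y. (l y)\<^sup>2)" "(LINT y|lebesgue. (l y)\<^sup>2) \<le> B"
      using square_integrable_Fatou[OF hs lm lim, of B] Ih by (auto simp: square_integrable_def)
    have le: "(u y)\<^sup>2 / weight (s - \<beta>) y \<le> r * ((u y)\<^sup>2 / weight s y) + (l y)\<^sup>2" for y
    proof (cases "norm y \<le> 2 * R")
      case True
      have "(u y)\<^sup>2 / weight (s - \<beta>) y \<le> (u y)\<^sup>2 / 1"
        using weight_ge_1[of "s - \<beta>" y] by (intro divide_left_mono) auto
      then show ?thesis using near[OF True, of u] zero_le_power2[of "l y"] by linarith
    next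
      case False
      then have "(l y)\<^sup>2 = (u y)\<^sup>2 / weight (s - \<beta>) y"
        by (simp add: l_def power_divide weight_pos less_imp_le)
      then show ?thesis using rn[of y] by simp
    qed
    have iu: "integrable lebesgue (\<lambda>y. (u y)\<^sup>2 / weight (s - \<beta>) y)"
    proof (rule Bochner_Integration.integrable_bound[OF Bochner_Integration.integrable_add[OF rus l(1)]])
      show "(\<lambda>y. (u y)\<^sup>2 / weight (s - \<beta>) y) \<in> borel_measurable lebesgue" by measurable
      show "AE y in lebesgue. norm ((u y)\<^sup>2 / weight (s - \<beta>) y) \<le> norm (r * ((u y)\<^sup>2 / weight s y) + (l y)\<^sup>2)"
      proof (intro always_eventually allI)
        fix y
        have "0 \<le> (u y)\<^sup>2 / weight (s - \<beta>) y" using weight_pos[of "s - \<beta>" y] by simp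
        then show "norm ((u y)\<^sup>2 / weight (s - \<beta>) y) \<le> norm (r * ((u y)\<^sup>2 / weight s y) + (l y)\<^sup>2)"
          using le[of y] by (simp only: real_norm_def)
      qed
    qed
    have "(LINT y|lebesgue. (u y)\<^sup>2 / weight (s - \<beta>) y) \<le> (LINT y|lebesgue. r * ((u y)\<^sup>2 / weight s y) + (l y)\<^sup>2)"
      by (intro integral_mono iu le Bochner_Integration.integrable_add rus l(1))
    also have "\<dots> = (LINT y|lebesgue. r * ((u y)\<^sup>2 / weight s y)) + (LINT y|lebesgue. (l y)\<^sup>2)"
      by (rule Bochner_Integration.integral_add[OF rus l(1)])
    also have "\<dots> \<le> r * C * V\<^sup>2 + (b1 * (r * C * V\<^sup>2) + G\<^sup>2 / \<kappa>\<^sup>2)"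
      using us2 l(2) mult_left_mono[OF U b1] by (simp add: B_def)
    also have "\<dots> = (r * C + b1 * (r * C)) * V\<^sup>2 + 1 / \<kappa>\<^sup>2 * G\<^sup>2"
      by (simp add: algebra_simps)
    also have "\<dots> \<le> M * V\<^sup>2 + M * G\<^sup>2"
      using M by (intro add_mono mult_right_mono) auto
    finally show ?thesis using iu by (simp add: G_def V_def algebra_simps)
  qed
  with M(1) show ?thesis by blast
qed

theorem proposition2p2:
  fixes \<Omega> :: "'a::euclidean_space set" and s \<alpha> \<beta> :: real
  assumes "bounded_lipschitz_domain \<Omega>"
    and "s \<in> {0<..<1}" and "\<alpha> > 0" and "\<beta> \<in> {0<..<s}"
  shows "\<exists>C>0. \<forall>f \<in> L2_space \<Omega>. \<forall>g \<in> L2w_dual_space (s + \<beta>) (exterior \<Omega>).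
    (\<exists>u. solution s \<alpha> \<Omega> f g u) \<and>
    (\<forall>u w. solution s \<alpha> \<Omega> f g u \<and> solution s \<alpha> \<Omega> f g w \<longrightarrow> (AE x in lebesgue. u x = w x)) \<and>
    (\<forall>u. solution s \<alpha> \<Omega> f g u \<longrightarrow> u \<in> L2w_space (s - \<beta>) \<and>
      L2w_norm (s - \<beta>) u \<le> C * (L2w_dual_norm (s + \<beta>) (exterior \<Omega>) g + V_norm s \<Omega> u))"
proof -
  have \<Omega>: "open \<Omega>" "bounded \<Omega>" "\<Omega> \<noteq> {}"
    using assms(1) by (auto simp: bounded_lipschitz_domain_def)
  have s: "0 < s" "s < 1" and \<beta>: "0 < \<beta>" "\<beta> < s" using assms by auto
  obtain M where M: "0 < M" and est: "\<And>f g u. g \<in> L2w_dual_space (s + \<beta>) (exterior \<Omega>) \<Longrightarrow> solution s \<alpha> \<Omega> f g u \<Longrightarrow>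
    integrable lebesgue (\<lambda>y. (u y)\<^sup>2 / weight (s - \<beta>) y) \<and>
    (LINT y|lebesgue. (u y)\<^sup>2 / weight (s - \<beta>) y)
      \<le> M * ((L2w_dual_norm (s + \<beta>) (exterior \<Omega>) g)\<^sup>2 + (V_norm s \<Omega> u)\<^sup>2)"
    using solution_L2w_estimate[OF \<Omega> s \<beta>, of \<alpha>] by blast
  have "u \<in> L2w_space (s - \<beta>) \<and>
      L2w_norm (s - \<beta>) u \<le> sqrt M * (L2w_dual_norm (s + \<beta>) (exterior \<Omega>) g + V_norm s \<Omega> u)"
    if g: "g \<in> L2w_dual_space (s + \<beta>) (exterior \<Omega>)" and sol: "solution s \<alpha> \<Omega> f g u" for f g u
  proof
    let ?G = "L2w_dual_norm (s + \<beta>) (exterior \<Omega>) g" and ?V = "V_norm s \<Omega> u"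
    show "u \<in> L2w_space (s - \<beta>)"
      using est[OF g sol] sol by (simp add: L2w_space_def solution_def V_space_iff)
    have nonneg: "0 \<le> ?G" "0 \<le> ?V"
      by (simp_all add: L2w_dual_norm_def V_norm_nonneg weight_pos less_imp_le)
    have "L2w_norm (s - \<beta>) u \<le> sqrt (M * (?G\<^sup>2 + ?V\<^sup>2))"
      using est[OF g sol] by (simp add: L2w_norm_def)
    also have "\<dots> \<le> sqrt (M * (?G + ?V)\<^sup>2)"
      using nonneg M by (intro real_sqrt_le_mono mult_left_mono) (auto simp: power2_sum)
    also have "\<dots> = sqrt M * (?G + ?V)"
      using nonneg by (simp add: real_sqrt_mult)
    finally show "L2w_norm (s - \<beta>) u \<le> sqrt M * (?G + ?V)" .
  qed
  then show ?thesis
    using M solution_exists[OF \<Omega> s assms(3) \<beta>(1)] solution_unique[OF \<Omega> s assms(3)]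
    by (intro exI[of _ "sqrt M"]) auto
qed

end
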